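(* There is a polynomial-time algorithm that, given a graph $G$ together with a rooted layout of $G$ of mim-width at most $1$, solves \textsc{Induced Polar Subgraph} on $G$, i.e., finds a maximum-size set $S\subseteq V(G)$ such that $G[S]$ is a polar graph.
   Context: A cluster graph is a graph whose every component is complete; a co-cluster graph is the complement of a cluster graph. $G$ is polar if $V(G)$ can be partitioned into $S_1,S_2$ with $G[S_1]$ a cluster graph and $G[S_2]$ a co-cluster graph. For $A\subseteq V(G)$, $\mathrm{mim}_G(A)$ is the maximum size of an induced matching among the edges between $A$ and $V(G)\setminus A$. A rooted layout of $G$ is $(T,L)$ with $T$ a rooted full binary tree with $|V(G)|$ leaves and $L$ a bijection from $V(G)$ to its leaves; each tree edge $e$ yields a bipartition $(A^e_1,A^e_2)$ of $V(G)$; its mim-width is $\max_e\mathrm{mim}_G(A^e_1)$. *)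

theory Defs
  imports "Graph_Theory.Kuratowski" "HOL-Computational_Algebra.Polynomial"
begin

section \<open>Graphs\<close>

text \<open>
  An undirected simple graph is a symmetric loop-free digraph, as in \<^locale>\<open>graph\<close> and
  \<^locale>\<open>pair_graph\<close>. Its connected components are then its strongly connected components.
\<close>

definition cluster_graph :: "('a, 'b) pre_digraph \<Rightarrow> bool" where
  "cluster_graph G \<longleftrightarrow>
     graph G \<and> (\<forall>C \<in> pre_digraph.sccs G. complete_digraph (card (verts C)) C)"

definition complement_graph :: "('a, 'b) pre_digraph \<Rightarrow> 'a pair_pre_digraph" where
  "complement_graph G =
     \<lparr> pverts = verts G,
       parcs = {(u, v). u \<in> verts G \<and> v \<in> verts G \<and> u \<noteq> v \<and> (u, v) \<notin> arcs_ends G} \<rparr>"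

definition co_cluster_graph :: "('a, 'b) pre_digraph \<Rightarrow> bool" where
  "co_cluster_graph G \<longleftrightarrow> graph G \<and> cluster_graph (with_proj (complement_graph G))"

text \<open>Either side of the partition may be empty.\<close>

definition polar_graph :: "('a, 'b) pre_digraph \<Rightarrow> bool" where
  "polar_graph G \<longleftrightarrow>
     (\<exists>S1 S2. S1 \<union> S2 = verts G \<and> S1 \<inter> S2 = {} \<and>
        cluster_graph (G \<restriction> S1) \<and> co_cluster_graph (G \<restriction> S2))"

section \<open>Rooted layouts and mim-width\<close>

definition cut_graph :: "('a, 'b) pre_digraph \<Rightarrow> 'a set \<Rightarrow> 'a pair_pre_digraph" where
  "cut_graph G A =
     \<lparr> pverts = verts G, parcs = {(u, v) \<in> arcs_ends G. u \<in> A \<longleftrightarrow> v \<notin> A} \<rparr>"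

text \<open>A matching is a set of undirected edges, each represented by its set of two ends.\<close>

definition induced_matching :: "('a, 'b) pre_digraph \<Rightarrow> 'a set set \<Rightarrow> bool" where
  "induced_matching G M \<longleftrightarrow>
     M \<subseteq> (\<lambda>(u, v). {u, v}) ` arcs_ends G \<and>
     (\<forall>e \<in> M. \<forall>f \<in> M. e \<noteq> f \<longrightarrow>
        e \<inter> f = {} \<and> (\<forall>u \<in> e. \<forall>v \<in> f. (u, v) \<notin> arcs_ends G))"

text \<open>
  The matching is induced in the bipartite graph of the edges across the cut; edges inside
  either side are disregarded.
\<close>

definition mim :: "('a, 'b) pre_digraph \<Rightarrow> 'a set \<Rightarrow> nat" where
  "mim G A = Max (card ` {M. induced_matching (with_proj (cut_graph G A)) M})"

text \<open>
  A full binary tree whose leaves are labelled by vertices represents the pair of the tree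
  and the bijection between vertices and leaves.
\<close>

datatype 'a layout = Leaf 'a | Fork "'a layout" "'a layout"

fun leaf_list :: "'a layout \<Rightarrow> 'a list" where
  "leaf_list (Leaf v) = [v]"
| "leaf_list (Fork l r) = leaf_list l @ leaf_list r"

definition rooted_layout :: "('a, 'b) pre_digraph \<Rightarrow> 'a layout \<Rightarrow> bool" where
  "rooted_layout G T \<longleftrightarrow> distinct (leaf_list T) \<and> set (leaf_list T) = verts G"

text \<open>
  A tree edge joins a fork to one of its children. Its bipartition is represented by the set
  of leaves below the child; \<^const>\<open>mim\<close> does not depend on which side is chosen.
\<close>

fun edge_cuts :: "'a layout \<Rightarrow> 'a set set" where
  "edge_cuts (Leaf v) = {}"
| "edge_cuts (Fork l r) =
     {set (leaf_list l), set (leaf_list r)} \<union> edge_cuts l \<union> edge_cuts r"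

text \<open>The inserted 0 only matters for a tree consisting of a single leaf, which has no edge.\<close>

definition mim_width :: "('a, 'b) pre_digraph \<Rightarrow> 'a layout \<Rightarrow> nat" where
  "mim_width G T = Max (insert 0 (mim G ` edge_cuts T))"

section \<open>Polynomial time\<close>

text \<open>
  The machine model is a first-order call-by-value language over binary trees, in the style of
  the languages WHILE and F of N. D. Jones. A program is a list of function bodies; variables are
  de Bruijn indices into the environment, which initially holds the arguments of the call.

  Whenever a value is copied, taken apart or built, its size is charged in addition to one unit
  per evaluation step. Hence all values occurring in a run of cost \<open>t\<close> have size at most \<open>t\<close>
  plus the input size, and a Turing machine simulates the run in time polynomial in \<open>t\<close> and the
  input size (charging one unit only would allow trees of exponential size by repeated sharing).
  Conversely, a Turing machine with tapes stored as lists is simulated with polynomial overhead.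
\<close>

datatype data = Atom | Dot data data

datatype expr =
    EVar nat
  | EAtom
  | EDot expr expr
  | EFst expr
  | ESnd expr
  | EIf expr expr expr
  | ELet expr expr
  | ECall nat "expr list"

fun dfst :: "data \<Rightarrow> data" where
  "dfst Atom = Atom"
| "dfst (Dot x y) = x"

fun dsnd :: "data \<Rightarrow> data" where
  "dsnd Atom = Atom"
| "dsnd (Dot x y) = y"

text \<open>\<open>eval P env e v t\<close>: in program \<open>P\<close>, expression \<open>e\<close> evaluates to \<open>v\<close> at cost \<open>t\<close>.\<close>

inductive
  eval :: "expr list \<Rightarrow> data list \<Rightarrow> expr \<Rightarrow> data \<Rightarrow> nat \<Rightarrow> bool" and
  evals :: "expr list \<Rightarrow> data list \<Rightarrow> expr list \<Rightarrow> data list \<Rightarrow> nat \<Rightarrow> bool"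
  for P :: "expr list"
where
  EVar: "i < length env \<Longrightarrow> eval P env (EVar i) (env ! i) (1 + size (env ! i))"
| EAtom: "eval P env EAtom Atom 1"
| EDot: "eval P env e1 v1 t1 \<Longrightarrow> eval P env e2 v2 t2 \<Longrightarrow>
    eval P env (EDot e1 e2) (Dot v1 v2) (t1 + t2 + 1 + size (Dot v1 v2))"
| EFst: "eval P env e v t \<Longrightarrow> eval P env (EFst e) (dfst v) (t + 1 + size v)"
| ESnd: "eval P env e v t \<Longrightarrow> eval P env (ESnd e) (dsnd v) (t + 1 + size v)"
| EIf_true: "eval P env e1 (Dot x y) t1 \<Longrightarrow> eval P env e2 v t2 \<Longrightarrow>
    eval P env (EIf e1 e2 e3) v (t1 + t2 + 1)"
| EIf_false: "eval P env e1 Atom t1 \<Longrightarrow> eval P env e3 v t3 \<Longrightarrow>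
    eval P env (EIf e1 e2 e3) v (t1 + t3 + 1)"
| ELet: "eval P env e1 v1 t1 \<Longrightarrow> eval P (v1 # env) e2 v2 t2 \<Longrightarrow>
    eval P env (ELet e1 e2) v2 (t1 + t2 + 1)"
| ECall: "evals P env es vs t1 \<Longrightarrow> f < length P \<Longrightarrow> eval P vs (P ! f) v t2 \<Longrightarrow>
    eval P env (ECall f es) v (t1 + t2 + 1)"
| evals_Nil: "evals P env [] [] 0"
| evals_Cons: "eval P env e v t1 \<Longrightarrow> evals P env es vs t2 \<Longrightarrow>
    evals P env (e # es) (v # vs) (t1 + t2)"

inductive_cases eval_elims:
  "eval P env (EVar i) v t"
  "eval P env EAtom v t"
  "eval P env (EDot e1 e2) v t"
  "eval P env (EFst e) v t"
  "eval P env (ESnd e) v t"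
  "eval P env (EIf e1 e2 e3) v t"
  "eval P env (ELet e1 e2) v t"
  "eval P env (ECall f es) v t"
inductive_cases evals_elims:
  "evals P env [] vs t"
  "evals P env (e # es) vs t"

lemma eval_deterministic:
  "eval P env e v t \<Longrightarrow> eval P env e v' t' \<Longrightarrow> v = v' \<and> t = t'"
  "evals P env es vs t \<Longrightarrow> evals P env es vs' t' \<Longrightarrow> vs = vs' \<and> t = t'"
proof (induction arbitrary: v' t' and vs' t' rule: eval_evals.inducts)
  case EVar
  from EVar.prems show ?case by (auto elim: eval_elims)
next
  case EAtom
  from EAtom.prems show ?case by (auto elim: eval_elims)
next
  case EDot
  from EDot.prems show ?case by (rule eval_elims) (auto dest: EDot.IH(2,4))
next
  case EFst
  from EFst.prems show ?case by (rule eval_elims) (auto dest: EFst.IH(2))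
next
  case ESnd
  from ESnd.prems show ?case by (rule eval_elims) (auto dest: ESnd.IH(2))
next
  case EIf_true
  from EIf_true.prems show ?case by (rule eval_elims) (auto dest: EIf_true.IH(2,4))
next
  case EIf_false
  from EIf_false.prems show ?case by (rule eval_elims) (auto dest: EIf_false.IH(2,4))
next
  case ELet
  from ELet.prems show ?case by (rule eval_elims) (auto dest: ELet.IH(2,4))
next
  case ECall
  from ECall.prems show ?case by (rule eval_elims) (auto dest: ECall.IH(2,5))
next
  case evals_Nil
  from evals_Nil.prems show ?case by (rule evals_elims) auto
next
  case evals_Cons
  from evals_Cons.prems show ?case by (rule evals_elims) (auto dest: evals_Cons.IH(2,4))
qed

text \<open>The main function is the first one of the program; it takes the input as sole argument.\<close>

definition run :: "expr list \<Rightarrow> data \<Rightarrow> data \<Rightarrow> nat \<Rightarrow> bool" where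
  "run P x y t \<longleftrightarrow> eval P [x] (ECall 0 [EVar 0]) y t"

text \<open>
  A single program returns, on every instance in \<open>I\<close>, some output related to the instance by
  \<open>sol\<close>, in time polynomial in the size of the encoded instance. Nothing is required of inputs
  that violate the promise \<open>I\<close>.
\<close>

definition poly_time_search ::
  "('i \<Rightarrow> data) \<Rightarrow> ('o \<Rightarrow> data) \<Rightarrow> 'i set \<Rightarrow> ('i \<Rightarrow> 'o \<Rightarrow> bool) \<Rightarrow> bool" where
  "poly_time_search enc_in enc_out I sol \<longleftrightarrow>
     (\<exists>P :: expr list. \<exists>p :: nat poly. \<forall>x \<in> I. \<exists>y t.
        run P (enc_in x) (enc_out y) t \<and> t \<le> poly p (size (enc_in x)) \<and> sol x y)"

section \<open>Encodings\<close>

fun enc_bool :: "bool \<Rightarrow> data" where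
  "enc_bool False = Atom"
| "enc_bool True = Dot Atom Atom"

text \<open>
  Numbers are written in unary. Only vertices below the order of the graph are encoded, so the
  size of an instance is polynomially related to the number of its vertices.
\<close>

fun enc_nat :: "nat \<Rightarrow> data" where
  "enc_nat 0 = Atom"
| "enc_nat (Suc k) = Dot Atom (enc_nat k)"

fun enc_list :: "('a \<Rightarrow> data) \<Rightarrow> 'a list \<Rightarrow> data" where
  "enc_list f [] = Atom"
| "enc_list f (x # xs) = Dot (f x) (enc_list f xs)"

text \<open>The adjacency matrix of a graph with vertices \<open>{..<n}\<close>.\<close>

definition enc_graph :: "nat pair_pre_digraph \<Rightarrow> data" where
  "enc_graph G = (let n = card (pverts G) in
     enc_list (\<lambda>u. enc_list (\<lambda>v. enc_bool ((u, v) \<in> parcs G)) [0..<n]) [0..<n])"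

text \<open>The first component tells leaves from forks.\<close>

fun enc_layout :: "nat layout \<Rightarrow> data" where
  "enc_layout (Leaf v) = Dot (enc_bool False) (enc_nat v)"
| "enc_layout (Fork l r) = Dot (enc_bool True) (Dot (enc_layout l) (enc_layout r))"

definition enc_instance :: "nat pair_pre_digraph \<times> nat layout \<Rightarrow> data" where
  "enc_instance = (\<lambda>(G, T). Dot (enc_graph G) (enc_layout T))"

text \<open>As usual for algorithmic input, the vertices of a graph are numbered from 0.\<close>

definition layout_instances :: "nat \<Rightarrow> (nat pair_pre_digraph \<times> nat layout) set" where
  "layout_instances k =
     {(G, T). pair_graph G \<and> pverts G = {..<card (pverts G)} \<and>
        rooted_layout (with_proj G) T \<and> mim_width (with_proj G) T \<le> k}"

definition max_induced_polar ::
  "nat pair_pre_digraph \<times> nat layout \<Rightarrow> nat list \<Rightarrow> bool" where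
  "max_induced_polar = (\<lambda>(G, T) xs. distinct xs \<and>
     is_arg_max card (\<lambda>S. S \<subseteq> pverts G \<and> polar_graph (with_proj G \<restriction> S)) (set xs))"

end

theory Submission
  imports Defs "HOL-Library.Multiset"
begin

text \<open>
  A bipartite graph without an induced matching of size two is a chain graph, so across every cut of
  the layout the neighbourhoods are nested. If \<open>S\<close> induces a cluster graph, then at most one clique
  of \<open>S\<close> crosses a given cut, as two of them would yield an induced matching of size two; for
  co-cluster graphs the same holds in the complement, whose cuts are chain graphs too. A partial
  solution below a tree node therefore consists of a crossing clique and the remaining vertices, for
  each of the two sides of the polar partition. What matters for its extensions are the common
  neighbourhood and the union of the neighbourhoods of these four sets outside the subtree. By
  nestedness each set has the same two neighbourhoods as the empty set or as a set of at most two
  vertices, so that dynamic programming over the layout, keeping a largest partial solution per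
  class, only has polynomially many classes.

  For polynomial time, the functions computed by polynomial-time programs are shown to be closed
  under the list operations in which the algorithm is written.
\<close>

section \<open>Polynomial-time functions on encoded values\<close>

text \<open>Completeness is an exchange argument: a stored partial solution need not be contained in
  the optimum that it stands for. Whether two halves may be joined depends only on complete or empty
  adjacency between their lists; common neighbourhoods decide the former, unions of neighbourhoods
  the latter, and complementation swaps the two. Hence one set of lemmas, with a Boolean choosing
  adjacency or non-adjacency, serves both sides of the partition, and a solution with the same
  neighbourhood data and at least as many vertices is as good as the original one. At a fork it is
  not known whether the merged clique will be extended further up, so both choices are kept. With
  \<open>n\<close> leaves below a node, each of the four sets has \<open>n * n + 1\<close> possible
  keys, which gives the bound \<open>(n * n + 1) ^ 4\<close>. The obstacle on the machine side is
  that recursion may let values grow exponentially. The closure rule for lists bounds the growth per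
  step; the one for trees asks for a separate polynomial bound on the results, which pruning
  supplies.\<close>

primrec shift :: "nat \<Rightarrow> expr \<Rightarrow> expr" where
  "shift k (EVar i) = EVar i"
| "shift k EAtom = EAtom"
| "shift k (EDot a b) = EDot (shift k a) (shift k b)"
| "shift k (EFst a) = EFst (shift k a)"
| "shift k (ESnd a) = ESnd (shift k a)"
| "shift k (EIf a b c) = EIf (shift k a) (shift k b) (shift k c)"
| "shift k (ELet a b) = ELet (shift k a) (shift k b)"
| "shift k (ECall f es) = ECall (k + f) (map (shift k) es)"

lemma shift_0 [simp]: "shift 0 e = e"
  by (induction e) (auto simp: map_idI)

text \<open>Calls name functions by position, so code placed behind the bodies \<open>A\<close> must
  have its calls moved by \<open>length A\<close>. Nothing else depends on the position, and the
  cost is unchanged. This allows programs to be combined.\<close>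

lemma eval_link:
  "eval P env e v t \<Longrightarrow>
     eval (A @ map (shift (length A)) P @ B) env (shift (length A) e) v t"
  "evals P env es vs t \<Longrightarrow>
     evals (A @ map (shift (length A)) P @ B) env (map (shift (length A)) es) vs t"
proof (induction rule: eval_evals.inducts)
  case (ECall env es vs t1 f v t2)
  then have "eval (A @ map (shift (length A)) P @ B) vs
      ((A @ map (shift (length A)) P @ B) ! (length A + f)) v t2"
    by (simp add: nth_append)
  from eval_evals.ECall[OF ECall.IH(2) _ this] ECall.IH(3) show ?case by simp
qed (unfold shift.simps list.map, (rule eval_evals.intros; assumption)+)

lemma eval_append: "eval P env e v t \<Longrightarrow> eval (P @ B) env e v t"
  using eval_link(1)[of P env e v t "[]" B] by (simp add: map_idI)

text \<open>Each rule either charges for the value that it builds, copies or takes apart, or passes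
  on the value of a subevaluation whose cost it includes. So time bounds yield size bounds, as
  needed for compositions.\<close>

lemma eval_size_le:
  "eval P env e v t \<Longrightarrow> size v \<le> t"
  "evals P env es vs t \<Longrightarrow> True"
proof (induction rule: eval_evals.inducts)
  case (EFst env e v t)
  then show ?case by (cases v) auto
next
  case (ESnd env e v t)
  then show ?case by (cases v) auto
qed auto

text \<open>The type determines the encoding, so \<open>poly_time\<close> needs no encoding
  arguments and its closure rules apply by plain unification.\<close>

class enc =
  fixes enc :: "'a \<Rightarrow> data"

instantiation unit :: enc
begin
definition enc_unit :: "unit \<Rightarrow> data" where "enc_unit _ = Atom"
instance ..
end

instantiation bool :: enc
begin
definition enc_bool_inst: "enc = enc_bool"
instance ..
end

instantiation nat :: enc
begin
definition enc_nat_inst: "enc = enc_nat"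
instance ..
end

instantiation list :: (enc) enc
begin
definition enc_list_inst: "enc = enc_list enc"
instance ..
end

instantiation prod :: (enc, enc) enc
begin
definition enc_prod :: "'a \<times> 'b \<Rightarrow> data" where "enc_prod z = Dot (enc (fst z)) (enc (snd z))"
instance ..
end

instantiation layout :: (enc) enc
begin
primrec enc_layout :: "'a layout \<Rightarrow> data" where
  "enc_layout (Leaf v) = Dot (enc False) (enc v)"
| "enc_layout (Fork l r) = Dot (enc True) (Dot (enc_layout l) (enc_layout r))"
instance ..
end

lemma enc_simps [simp]:
  "enc () = Atom"
  "enc False = Atom"
  "enc True = Dot Atom Atom"
  "enc (0::nat) = Atom"
  "enc (Suc n) = Dot Atom (enc n)"
  "enc ([]::'a::enc list) = Atom"
  "enc (x # xs) = Dot (enc x) (enc xs)"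
  "enc (a, b) = Dot (enc a) (enc b)"
  "enc (Leaf v) = Dot Atom (enc v)"
  "enc (Fork l r) = Dot (Dot Atom Atom) (Dot (enc l) (enc r))"
  by (simp_all add: enc_unit_def enc_bool_inst enc_nat_inst enc_list_inst enc_prod_def)

declare enc_layout.simps [simp del]

lemma length_le_size_enc: "length xs \<le> size (enc xs)"
  by (induction xs) auto

lemma size_enc_member: "x \<in> set xs \<Longrightarrow> size (enc x) \<le> size (enc xs)"
  by (induction xs) auto

lemma size_enc_append [simp]: "size (enc (xs @ ys)) = size (enc xs) + size (enc ys)"
  by (induction xs) auto

lemma size_enc_bool_le: "size (enc b) \<le> 1" for b :: bool
  by (cases b) auto

section \<open>Polynomial bounds in the size of the encoded argument\<close>

definition poly_bounded :: "('a::enc \<Rightarrow> nat) \<Rightarrow> bool" where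
  "poly_bounded T \<longleftrightarrow> (\<exists>p. \<forall>x. T x \<le> poly p (size (enc x)))"

lemma poly_nat_mono: "x \<le> y \<Longrightarrow> poly p x \<le> poly p y" for x y :: nat
  by (induction p) (auto intro: add_mono mult_mono)

lemma poly_boundedI: "(\<And>x. T x \<le> poly p (size (enc x))) \<Longrightarrow> poly_bounded T"
  unfolding poly_bounded_def by blast

lemma poly_boundedE:
  assumes "poly_bounded T"
  obtains p where "\<And>x. T x \<le> poly p (size (enc x))"
  using assms unfolding poly_bounded_def by blast

lemma poly_bounded_mono:
  assumes "poly_bounded T" "\<And>x. T' x \<le> T x"
  shows "poly_bounded T'"
  using assms unfolding poly_bounded_def by (meson le_trans)

lemma poly_bounded_const: "poly_bounded (\<lambda>_. c)"
  by (rule poly_boundedI[where p = "[:c:]"]) simp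

lemma poly_bounded_size: "poly_bounded (\<lambda>x. size (enc x))"
  by (rule poly_boundedI[where p = "[:0, 1:]"]) simp

lemma poly_bounded_add:
  assumes "poly_bounded S" "poly_bounded T"
  shows "poly_bounded (\<lambda>x. S x + T x)"
proof -
  from assms obtain p q where "\<And>x. S x \<le> poly p (size (enc x))" "\<And>x. T x \<le> poly q (size (enc x))"
    by (metis poly_boundedE)
  then show ?thesis
    by (intro poly_boundedI[where p = "p + q"]) (simp add: add_mono)
qed

lemma poly_bounded_mult:
  assumes "poly_bounded S" "poly_bounded T"
  shows "poly_bounded (\<lambda>x. S x * T x)"
proof -
  from assms obtain p q where "\<And>x. S x \<le> poly p (size (enc x))" "\<And>x. T x \<le> poly q (size (enc x))"
    by (metis poly_boundedE)
  then show ?thesis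
    by (intro poly_boundedI[where p = "p * q"]) (simp add: mult_mono)
qed

lemma poly_bounded_poly:
  assumes "poly_bounded T"
  shows "poly_bounded (\<lambda>x. poly p (T x))"
proof -
  from assms obtain q where "\<And>x. T x \<le> poly q (size (enc x))"
    by (metis poly_boundedE)
  then show ?thesis
    by (intro poly_boundedI[where p = "pcompose p q"]) (simp add: poly_pcompose poly_nat_mono)
qed

lemma poly_bounded_comp:
  assumes "poly_bounded T" "poly_bounded (\<lambda>x. size (enc (f x)))"
  shows "poly_bounded (\<lambda>x. T (f x))"
proof -
  from assms(1) obtain p where "\<And>x. T x \<le> poly p (size (enc x))"
    by (metis poly_boundedE)
  with poly_bounded_poly[OF assms(2), of p] show ?thesis
    by (rule poly_bounded_mono)
qed

lemmas poly_bounded_intros =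
  poly_bounded_const poly_bounded_add poly_bounded_mult poly_bounded_size

text \<open>There is always one argument; functions of several arguments take nested pairs, hence
  the projections \<open>fst (snd z)\<close> in later rules. The expression \<open>e\<close> is kept
  apart from the program \<open>P\<close> so that it can be used inline or appended as a further
  body.\<close>

definition computes ::
  "expr list \<Rightarrow> expr \<Rightarrow> ('a::enc \<Rightarrow> 'b::enc) \<Rightarrow> ('a \<Rightarrow> nat) \<Rightarrow> bool" where
  "computes P e f T \<longleftrightarrow> (\<forall>x. \<exists>t \<le> T x. eval P [enc x] e (enc (f x)) t)"

definition poly_time :: "('a::enc \<Rightarrow> 'b::enc) \<Rightarrow> bool" where
  "poly_time f \<longleftrightarrow> (\<exists>P e T. computes P e f T \<and> poly_bounded T)"

lemma computesE:
  assumes "computes P e f T"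
  obtains t where "t \<le> T x" "eval P [enc x] e (enc (f x)) t"
  using assms unfolding computes_def by blast

lemma computes_link:
  "computes P e f T \<Longrightarrow> computes (A @ map (shift (length A)) P @ B) (shift (length A) e) f T"
  unfolding computes_def using eval_link(1) by blast

lemma computes_append: "computes P e f T \<Longrightarrow> computes (P @ B) e f T"
  unfolding computes_def using eval_append by blast

lemma poly_timeI: "computes P e f T \<Longrightarrow> poly_bounded T \<Longrightarrow> poly_time f"
  unfolding poly_time_def by blast

lemma poly_time_common:
  assumes "poly_time f" "poly_time g"
  obtains P a b S T where "computes P a f S" "poly_bounded S" "computes P b g T" "poly_bounded T"
proof -
  from assms obtain P a S Q b T where
    f: "computes P a f S" "poly_bounded S" and g: "computes Q b g T" "poly_bounded T"
    unfolding poly_time_def by blast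
  from that[OF computes_append[OF f(1)] f(2), OF _ g(2)] computes_link[OF g(1), of P "[]"]
  show thesis by (metis append_Nil2)
qed

lemma poly_time_common3:
  assumes "poly_time f" "poly_time g" "poly_time h"
  obtains P a b c S T U where "computes P a f S" "poly_bounded S" "computes P b g T" "poly_bounded T"
    "computes P c h U" "poly_bounded U"
proof -
  from poly_time_common[OF assms(1,2)] obtain P a b S T where
    f: "computes P a f S" "poly_bounded S" and g: "computes P b g T" "poly_bounded T" .
  from assms obtain Q c U where
    h: "computes Q c h U" "poly_bounded U"
    unfolding poly_time_def by blast
  from that[OF computes_append[OF f(1)] f(2) computes_append[OF g(1)] g(2), OF _ h(2)]
    computes_link[OF h(1), of P "[]"]
  show thesis by (metis append_Nil2)
qed

lemma poly_time_size:
  assumes "poly_time f"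
  shows "poly_bounded (\<lambda>x. size (enc (f x)))"
proof -
  from assms obtain P e T where f: "computes P e f T" "poly_bounded T"
    unfolding poly_time_def by blast
  show ?thesis
    by (rule poly_bounded_mono[OF f(2)]) (meson f(1) computesE eval_size_le(1) le_trans)
qed

lemma eval_eqI: "eval P env e v t \<Longrightarrow> v = v' \<Longrightarrow> t = t' \<Longrightarrow> eval P env e v' t'"
  by simp

lemma eval_EVar: "i < length env \<Longrightarrow> v = env ! i \<Longrightarrow> eval P env (EVar i) v (1 + size v)"
  using eval_evals.EVar by blast

named_theorems poly_time_intros

lemma poly_time_id [poly_time_intros]: "poly_time (\<lambda>x. x)"
proof (rule poly_timeI)
  show "computes [] (EVar 0) (\<lambda>x::'a. x) (\<lambda>x. 1 + size (enc x))"
    unfolding computes_def by (metis eval_EVar length_Cons nth_Cons_0 order_refl zero_less_Suc)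
qed (intro poly_bounded_intros)

lemma poly_time_const [poly_time_intros]: "poly_time (\<lambda>_. c)"
proof -
  \<comment> \<open>Any fixed value is written out as nested \<open>EDot\<close> and
    \<open>EAtom\<close>, at a cost that does not depend on the environment.\<close>
  have "\<exists>e t. \<forall>env. eval [] env e d t" for d
    by (induction d) (meson eval_evals.EAtom eval_evals.EDot)+
  then obtain e t where "\<And>env. eval [] env e (enc c) t" by blast
  then have "computes [] e (\<lambda>_. c) (\<lambda>_. t)"
    unfolding computes_def by blast
  then show ?thesis by (rule poly_timeI) (intro poly_bounded_intros)
qed

text \<open>The code of \<open>g\<close> expects an environment holding only its argument. A call
  provides this, whereas \<open>ELet\<close> would keep the old entries; so \<open>b\<close> is
  appended as a new body and called.\<close>

lemma poly_time_compose:
  assumes "poly_time g" "poly_time f"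
  shows "poly_time (\<lambda>x. g (f x))"
proof -
  from poly_time_common[OF assms] obtain P b a T S where
    g: "computes P b g T" "poly_bounded T" and f: "computes P a f S" "poly_bounded S" .
  have "computes (P @ [b]) (ECall (length P) [a]) (\<lambda>x. g (f x)) (\<lambda>x. S x + T (f x) + 1)"
    unfolding computes_def
  proof
    fix x
    from computesE[OF f(1)] obtain s where s: "s \<le> S x" "eval P [enc x] a (enc (f x)) s" .
    from computesE[OF g(1)] obtain t where
      t: "t \<le> T (f x)" "eval P [enc (f x)] b (enc (g (f x))) t" .
    have "eval (P @ [b]) [enc x] (ECall (length P) [a]) (enc (g (f x))) (s + 0 + t + 1)"
      by (rule eval_evals.intros eval_append s t | simp)+
    then show "\<exists>t\<le>S x + T (f x) + 1.
        eval (P @ [b]) [enc x] (ECall (length P) [a]) (enc (g (f x))) t"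
      using s t by (intro exI[of _ "s + 0 + t + 1"]) simp
  qed
  then show ?thesis
    by (rule poly_timeI) (intro poly_bounded_intros f poly_bounded_comp[OF g(2)] poly_time_size assms)
qed

lemma poly_time_Pair [poly_time_intros]:
  assumes "poly_time f" "poly_time g"
  shows "poly_time (\<lambda>x. (f x, g x))"
proof -
  from poly_time_common[OF assms] obtain P a b S T where
    f: "computes P a f S" "poly_bounded S" and g: "computes P b g T" "poly_bounded T" .
  have "computes P (EDot a b) (\<lambda>x. (f x, g x))
      (\<lambda>x. S x + T x + 1 + (size (enc (f x)) + size (enc (g x)) + 1))"
    unfolding computes_def
  proof
    fix x
    from computesE[OF f(1)] obtain s where s: "s \<le> S x" "eval P [enc x] a (enc (f x)) s" .
    from computesE[OF g(1)] obtain t where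
      t: "t \<le> T x" "eval P [enc x] b (enc (g x)) t" .
    show "\<exists>t\<le>S x + T x + 1 + (size (enc (f x)) + size (enc (g x)) + 1).
        eval P [enc x] (EDot a b) (enc (f x, g x)) t"
      using eval_evals.EDot[OF s(2) t(2)] s t
      by (auto intro!: exI[of _ "s + t + 1 + (size (enc (f x)) + size (enc (g x)) + 1)"])
  qed
  then show ?thesis
    by (rule poly_timeI) (intro poly_bounded_intros f g poly_time_size assms)
qed

text \<open>Accessors are computed by the same expression for all types with such an encoding.\<close>

lemma poly_time_EFst:
  assumes "\<And>x. enc (g x) = dfst (enc x)"
  shows "poly_time g"
proof (rule poly_timeI)
  show "computes [] (EFst (EVar 0)) g (\<lambda>x. 1 + size (enc x) + 1 + size (enc x))"
    unfolding computes_def assms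
    by (metis eval_evals.EFst[OF eval_EVar] length_Cons nth_Cons_0 order_refl zero_less_Suc)
qed (intro poly_bounded_intros)

lemma poly_time_ESnd:
  assumes "\<And>x. enc (g x) = dsnd (enc x)"
  shows "poly_time g"
proof (rule poly_timeI)
  show "computes [] (ESnd (EVar 0)) g (\<lambda>x. 1 + size (enc x) + 1 + size (enc x))"
    unfolding computes_def assms
    by (metis eval_evals.ESnd[OF eval_EVar] length_Cons nth_Cons_0 order_refl zero_less_Suc)
qed (intro poly_bounded_intros)

lemma poly_time_same_enc:
  assumes "poly_time f" "\<And>x. enc (g x) = enc (f x)"
  shows "poly_time g"
  using assms unfolding poly_time_def computes_def by simp

lemma poly_time_fst [poly_time_intros]: "poly_time f \<Longrightarrow> poly_time (\<lambda>x. fst (f x))"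
  by (rule poly_time_compose[where g = fst]) (auto intro!: poly_time_EFst)

lemma poly_time_snd [poly_time_intros]: "poly_time f \<Longrightarrow> poly_time (\<lambda>x. snd (f x))"
  by (rule poly_time_compose[where g = snd]) (auto intro!: poly_time_ESnd)

text \<open>The condition may have any type, so that it can test for the empty list or for zero.\<close>

lemma poly_time_branch:
  assumes "poly_time b" "poly_time f" "poly_time g"
    and "\<And>x. h x = (if enc (b x) = Atom then g x else f x)"
  shows "poly_time h"
proof -
  from poly_time_common3[OF assms(1-3)] obtain P a c d S T U where
    b: "computes P a b S" "poly_bounded S" and f: "computes P c f T" "poly_bounded T"
    and g: "computes P d g U" "poly_bounded U" .
  have "computes P (EIf a c d) h (\<lambda>x. S x + (T x + U x) + 1)"
    unfolding computes_def
  proof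
    fix x
    from computesE[OF b(1)] obtain s where s: "s \<le> S x" "eval P [enc x] a (enc (b x)) s" .
    from computesE[OF f(1)] obtain t where t: "t \<le> T x" "eval P [enc x] c (enc (f x)) t" .
    from computesE[OF g(1)] obtain u where u: "u \<le> U x" "eval P [enc x] d (enc (g x)) u" .
    show "\<exists>t\<le>S x + (T x + U x) + 1. eval P [enc x] (EIf a c d) (enc (h x)) t"
    proof (cases "enc (b x)")
      case Atom
      with s have "eval P [enc x] a Atom s" by simp
      from eval_evals.EIf_false[OF this u(2)] Atom s u assms(4) show ?thesis
        by (intro exI[of _ "s + u + 1"]) auto
    next
      case (Dot y z)
      with s have "eval P [enc x] a (Dot y z) s" by simp
      from eval_evals.EIf_true[OF this t(2)] Dot s t assms(4) show ?thesis
        by (intro exI[of _ "s + t + 1"]) auto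
    qed
  qed
  then show ?thesis
    by (rule poly_timeI) (intro poly_bounded_intros b f g)
qed

lemma poly_time_if [poly_time_intros]:
  assumes "poly_time b" "poly_time f" "poly_time g"
  shows "poly_time (\<lambda>x. if b x then f x else g x)"
  by (rule poly_time_branch[OF assms]) (metis data.simps(3) enc_simps(2,3))

text \<open>The environment of \<open>loop\<close> holds the remaining list, the accumulator and the
  parameter \<open>x\<close>; function \<open>n\<close> is the step and \<open>n + 1\<close> the
  loop itself. The size of the accumulator plus \<open>d\<close> for each remaining element never
  exceeds \<open>b\<close>, so \<open>k\<close> bounds every step, and each of the
  \<open>length ys + 1\<close> rounds costs at most the factor in parentheses, whose coefficients
  leave room for copying values.\<close>

lemma eval_fold_loop:
  fixes F :: "'a::enc \<Rightarrow> 'b::enc \<Rightarrow> 'c::enc \<Rightarrow> 'c"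
  assumes f: "computes P e (\<lambda>z. F (fst z) (fst (snd z)) (snd (snd z))) T"
    and n: "n = length P"
    and loop: "loop = EIf (EVar 0)
      (ECall (n + 1) [ESnd (EVar 0),
        ECall n [EDot (EVar 2) (EDot (EFst (EVar 0)) (EVar 1))], EVar 2]) (EVar 1)"
    and growth: "\<And>y c. y \<in> set ys \<Longrightarrow> size (enc (F x y c)) \<le> size (enc c) + d"
    and cost: "\<And>y c. y \<in> set ys \<Longrightarrow> size (enc c) \<le> b \<Longrightarrow> T (x, (y, c)) \<le> k"
  shows "size (enc c) + length ys * d \<le> b \<Longrightarrow>
    \<exists>t \<le> (length ys + 1) * (k + 5 * size (enc x) + 10 * size (enc ys) + 4 * b + 40).
      eval (P @ [e, loop]) [enc ys, enc c, enc x] loop (enc (fold (F x) ys c)) t"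
  using growth cost
proof (induction ys arbitrary: c)
  case Nil
  have "eval (P @ [e, loop]) [enc ([]::'b list), enc c, enc x] loop (enc c)
    (1 + size Atom + (1 + size (enc c)) + 1)"
    unfolding loop by (intro eval_evals.EIf_false eval_EVar eval_eqI[OF eval_EVar]) auto
  with Nil show ?case by (intro exI[of _ "1 + size Atom + (1 + size (enc c)) + 1"]) auto
next
  case (Cons y ys)
  let ?Q = "P @ [e, loop]"
  let ?env = "[enc (y # ys), enc c, enc x]"
  let ?c = "F x y c"
  let ?K = "k + 5 * size (enc x) + 10 * size (enc (y # ys)) + 4 * b + 40"
  have c: "size (enc c) \<le> b" using Cons.prems(1) by simp
  have "size (enc ?c) + length ys * d \<le> b"
    using Cons.prems(1) Cons.prems(2)[of y c] by simp
  then obtain t where t: "t \<le> (length ys + 1) * (k + 5 * size (enc x) + 10 * size (enc ys) + 4 * b + 40)"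
    "eval ?Q [enc ys, enc ?c, enc x] loop (enc (fold (F x) ys ?c)) t"
    using Cons.IH[of ?c] Cons.prems(2,3) by (meson list.set_intros(2))
  from computesE[OF f, where x = "(x, (y, c))"] obtain s where s: "s \<le> T (x, (y, c))"
    "eval P [enc (x, (y, c))] e (enc ?c) s"
    unfolding fst_conv snd_conv .
  let ?arg = "1 + size (enc x) + ((1 + size (enc (y # ys))) + 1 + size (enc (y # ys)) +
    (1 + size (enc c)) + 1 + size (enc (y, c))) + 1 + size (enc (x, (y, c)))"
  have "eval ?Q ?env (EDot (EVar 2) (EDot (EFst (EVar 0)) (EVar 1))) (enc (x, (y, c))) ?arg"
    unfolding enc_simps
    by (rule eval_evals.EDot eval_EVar eval_eqI[OF eval_evals.EFst[OF eval_EVar]] | simp)+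
  moreover have "eval ?Q [enc (x, (y, c))] (?Q ! n) (enc ?c) s"
    using eval_append[OF s(2), of "[e, loop]"] n by simp
  ultimately have F: "eval ?Q ?env (ECall n [EDot (EVar 2) (EDot (EFst (EVar 0)) (EVar 1))])
      (enc ?c) (?arg + 0 + s + 1)"
    using n by (intro eval_evals.ECall[OF eval_evals.evals_Cons[OF _ eval_evals.evals_Nil]]) auto
  let ?t = "1 + size (enc (y # ys)) + (1 + size (enc (y # ys)) + 1 + size (enc (y # ys)) +
    (?arg + 0 + s + 1 + (1 + size (enc x) + 0)) + t + 1) + 1"
  have "eval ?Q ?env loop (enc (fold (F x) ys ?c)) ?t"
    unfolding loop
  proof (rule eval_evals.EIf_true)
    show "eval (P @ [e, EIf (EVar 0) (ECall (n + 1) [ESnd (EVar 0),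
        ECall n [EDot (EVar 2) (EDot (EFst (EVar 0)) (EVar 1))], EVar 2]) (EVar 1)]) ?env (EVar 0)
        (Dot (enc y) (enc ys)) (1 + size (enc (y # ys)))"
      by (rule eval_eqI[OF eval_EVar]) auto
  next
    have "eval ?Q ?env (ESnd (EVar 0)) (enc ys)
        (1 + size (enc (y # ys)) + 1 + size (enc (y # ys)))"
      by (rule eval_eqI[OF eval_evals.ESnd[OF eval_EVar]]) auto
    moreover have "eval ?Q ?env (EVar 2) (enc x) (1 + size (enc x))"
      by (rule eval_EVar) auto
    ultimately have "evals ?Q ?env [ESnd (EVar 0),
        ECall n [EDot (EVar 2) (EDot (EFst (EVar 0)) (EVar 1))], EVar 2] [enc ys, enc ?c, enc x]
        (1 + size (enc (y # ys)) + 1 + size (enc (y # ys)) + (?arg + 0 + s + 1 + (1 + size (enc x) + 0)))"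
      using F by (intro eval_evals.evals_Cons eval_evals.evals_Nil)
    moreover have "n + 1 < length ?Q" using n by simp
    moreover have "eval ?Q [enc ys, enc ?c, enc x] (?Q ! (n + 1)) (enc (fold (F x) ys ?c)) t"
      using t(2) n by (simp only: nth_append) simp
    ultimately show "eval (P @ [e, EIf (EVar 0) (ECall (n + 1) [ESnd (EVar 0),
        ECall n [EDot (EVar 2) (EDot (EFst (EVar 0)) (EVar 1))], EVar 2]) (EVar 1)]) ?env
        (ECall (n + 1) [ESnd (EVar 0),
        ECall n [EDot (EVar 2) (EDot (EFst (EVar 0)) (EVar 1))], EVar 2]) (enc (fold (F x) ys ?c))
        (1 + size (enc (y # ys)) + 1 + size (enc (y # ys)) +
    (?arg + 0 + s + 1 + (1 + size (enc x) + 0)) + t + 1)"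
      unfolding loop[symmetric] by (rule eval_evals.ECall)
  qed
  moreover have "?t \<le> (length (y # ys) + 1) * ?K"
  proof -
    have "s \<le> k" using s(1) Cons.prems(3)[of y c] c by simp
    then have "?t \<le> ?K + t" using c by simp
    also have "t \<le> (length ys + 1) * ?K"
      using t(1) by (rule le_trans) (intro mult_le_mono2, simp)
    also have "?K + (length ys + 1) * ?K = (length (y # ys) + 1) * ?K"
      unfolding list.size(4) Suc_eq_plus1 by (simp only: distrib_right mult_1_left)
    finally show ?thesis by simp_all
  qed
  ultimately show ?case unfolding fold_simps by blast
qed

text \<open>
  Iteration with accumulators of additively bounded growth. An unrestricted fold would leave
  polynomial time, since a step could double the size of the accumulator.
\<close>

lemma poly_time_fold:
  fixes F :: "'a::enc \<Rightarrow> 'b::enc \<Rightarrow> 'c::enc \<Rightarrow> 'c"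
  assumes F: "poly_time (\<lambda>z. F (fst z) (fst (snd z)) (snd (snd z)))"
    and L: "poly_time L" and z: "poly_time z"
    and D: "poly_bounded (\<lambda>z. D (fst z) (snd z))"
    and growth: "\<And>x y c. size (enc (F x y c)) \<le> size (enc c) + D x y"
  shows "poly_time (\<lambda>x. fold (F x) (L x) (z x))"
proof -
  from F obtain P e T where f: "computes P e (\<lambda>z. F (fst z) (fst (snd z)) (snd (snd z))) T"
    and T: "poly_bounded T"
    unfolding poly_time_def by blast
  obtain q where q: "\<And>z. T z \<le> poly q (size (enc z))"
    using T unfolding poly_bounded_def by blast
  obtain d where d: "\<And>z. D (fst z) (snd z) \<le> poly d (size (enc z))"
    using D unfolding poly_bounded_def by blast
  define loop where "loop = EIf (EVar 0)
      (ECall (length P + 1) [ESnd (EVar 0),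
        ECall (length P) [EDot (EVar 2) (EDot (EFst (EVar 0)) (EVar 1))], EVar 2]) (EVar 1)"
  \<comment> \<open>An element is no larger than the list, so \<open>inc\<close> bounds the growth
    for all elements at once, \<open>b\<close> the accumulator throughout, and \<open>k\<close> one
    step. The extra 1 in \<open>k\<close> is the second pair constructor in the argument
    \<open>(x, (y, c))\<close>.\<close>
  define inc where "inc x = poly d (size (enc (x, L x)))" for x
  define b where "b x = size (enc (z x)) + size (enc (L x)) * inc x" for x
  define k where "k x = poly q (size (enc (x, L x)) + 1 + b x)" for x
  define U where "U x = (size (enc (L x)) + 1) *
    (k x + 5 * size (enc x) + 10 * size (enc (L x)) + 4 * b x + 40)" for x
  have run: "\<exists>t \<le> U x. eval (P @ [e, loop]) [enc (L x), enc (z x), enc x] loop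
      (enc (fold (F x) (L x) (z x))) t" for x
  proof -
    have total: "size (enc (z x)) + length (L x) * inc x \<le> b x"
      unfolding b_def by (simp add: length_le_size_enc)
    have step: "size (enc (F x y c)) \<le> size (enc c) + inc x" if "y \<in> set (L x)" for y c
    proof -
      have "D x y \<le> poly d (size (enc (x, y)))" using d[of "(x, y)"] by simp
      also have "\<dots> \<le> inc x" unfolding inc_def
        by (rule poly_nat_mono) (simp add: size_enc_member that)
      finally show ?thesis using growth[of x y c] by simp
    qed
    have cost: "T (x, (y, c)) \<le> k x" if "y \<in> set (L x)" "size (enc c) \<le> b x" for y c
      using q[of "(x, (y, c))"] unfolding k_def
      by (rule le_trans) (rule poly_nat_mono, use that size_enc_member[of y "L x"] in simp)
    from eval_fold_loop[OF f refl loop_def step cost total]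
    obtain t where t: "t \<le> (length (L x) + 1) *
        (k x + 5 * size (enc x) + 10 * size (enc (L x)) + 4 * b x + 40)"
      "eval (P @ [e, loop]) [enc (L x), enc (z x), enc x] loop (enc (fold (F x) (L x) (z x))) t"
      by blast
    moreover have "(length (L x) + 1) *
        (k x + 5 * size (enc x) + 10 * size (enc (L x)) + 4 * b x + 40) \<le> U x"
      unfolding U_def by (intro mult_le_mono1) (simp add: length_le_size_enc)
    ultimately show ?thesis by (meson le_trans)
  qed
  define N where "N = length (P @ [e, loop])"
  have "poly_time (\<lambda>x. (L x, (z x, x)))"
    by (intro poly_time_intros L z)
  then obtain Q a A where A: "computes Q a (\<lambda>x. (L x, (z x, x))) A" "poly_bounded A"
    unfolding poly_time_def by blast
  define R where "R = (P @ [e, loop]) @ map (shift N) Q"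
  \<comment> \<open>The three arguments of the loop are computed once as a tuple and then projected
    out of the bound variable.\<close>
  define main where "main = ELet (shift N a)
    (ECall (length P + 1) [EFst (EVar 0), EFst (ESnd (EVar 0)), ESnd (ESnd (EVar 0))])"
  have "computes R main (\<lambda>x. fold (F x) (L x) (z x))
    (\<lambda>x. A x + (20 + 20 * size (enc (L x, (z x, x))) + U x))"
    unfolding computes_def
  proof
    fix x
    let ?v = "enc (L x, (z x, x))"
    have "computes R (shift N a) (\<lambda>x. (L x, (z x, x))) A"
      using computes_link[OF A(1), of "P @ [e, loop]" "[]"] by (simp add: R_def N_def)
    then obtain s where s: "s \<le> A x" "eval R [enc x] (shift N a) ?v s"
      by (rule computesE)
    from run[of x] obtain t where t: "t \<le> U x"
      "eval R [enc (L x), enc (z x), enc x] loop (enc (fold (F x) (L x) (z x))) t"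
      unfolding R_def using eval_append by blast
    let ?s = "1 + size ?v + 1 + size ?v"
    let ?u = "size (enc (z x, x))"
    have "eval R [?v, enc x] (EFst (EVar 0)) (enc (L x)) ?s"
      by (rule eval_eqI[OF eval_evals.EFst[OF eval_EVar]]) auto
    moreover have "eval R [?v, enc x] (EFst (ESnd (EVar 0))) (enc (z x)) (?s + 1 + ?u)"
      by (rule eval_eqI[OF eval_evals.EFst[OF eval_evals.ESnd[OF eval_EVar]]]) auto
    moreover have "eval R [?v, enc x] (ESnd (ESnd (EVar 0))) (enc x) (?s + 1 + ?u)"
      by (rule eval_eqI[OF eval_evals.ESnd[OF eval_evals.ESnd[OF eval_EVar]]]) auto
    ultimately have "evals R [?v, enc x]
        [EFst (EVar 0), EFst (ESnd (EVar 0)), ESnd (ESnd (EVar 0))]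
        [enc (L x), enc (z x), enc x] (?s + (?s + 1 + ?u + (?s + 1 + ?u + 0)))"
      by (intro eval_evals.evals_Cons eval_evals.evals_Nil)
    moreover have "length P + 1 < length R"
      by (simp add: R_def)
    moreover have "eval R [enc (L x), enc (z x), enc x] (R ! (length P + 1))
        (enc (fold (F x) (L x) (z x))) t"
      using t(2) by (simp add: R_def nth_append)
    ultimately have "eval R [?v, enc x]
        (ECall (length P + 1) [EFst (EVar 0), EFst (ESnd (EVar 0)), ESnd (ESnd (EVar 0))])
        (enc (fold (F x) (L x) (z x))) (?s + (?s + 1 + ?u + (?s + 1 + ?u + 0)) + t + 1)"
      by (rule eval_evals.ECall)
    from eval_evals.ELet[OF s(2) this]
    have "eval R [enc x] main (enc (fold (F x) (L x) (z x)))
        (s + (?s + (?s + 1 + ?u + (?s + 1 + ?u + 0)) + t + 1) + 1)"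
      unfolding main_def .
    moreover have "s + (?s + (?s + 1 + ?u + (?s + 1 + ?u + 0)) + t + 1) + 1
        \<le> A x + (20 + 20 * size ?v + U x)"
      using s(1) t(1) by simp
    ultimately show "\<exists>t\<le>A x + (20 + 20 * size (enc (L x, (z x, x))) + U x).
        eval R [enc x] main (enc (fold (F x) (L x) (z x))) t"
      by blast
  qed
  moreover have "poly_bounded (\<lambda>x. A x + (20 + 20 * size (enc (L x, (z x, x))) + U x))"
    unfolding U_def k_def b_def inc_def
    by (intro poly_bounded_intros A poly_bounded_poly poly_time_size poly_time_intros L z)
  ultimately show ?thesis by (rule poly_timeI)
qed

text \<open>Functions \<open>n\<close>, \<open>n + 1\<close> and \<open>n + 2\<close> are the leaf
  case, the combination and the recursion itself. Given that all intermediate results have size at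
  most \<open>b\<close>, one node costs at most the factor in parentheses, beyond its recursive
  calls. An encoded fork has the sizes of its children plus 3, and an encoded leaf has positive
  size, so the sizes pay for one factor per node.\<close>

lemma eval_layout_rec:
  fixes g :: "'a::enc \<Rightarrow> 'v::enc \<Rightarrow> 'b::enc"
    and c :: "'a \<Rightarrow> 'v layout \<Rightarrow> 'v layout \<Rightarrow> 'b \<Rightarrow> 'b \<Rightarrow> 'b"
  assumes g: "computes P a (\<lambda>z. g (fst z) (snd z)) S"
    and c: "computes P e (\<lambda>z. c (fst z) (fst (snd z)) (fst (snd (snd z)))
      (fst (snd (snd (snd z)))) (snd (snd (snd (snd z))))) T"
    and n: "n = length P"
    and left: "lexp = EFst (ESnd (EVar 0))" and right: "rexp = ESnd (ESnd (EVar 0))"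
    and loop: "loop = EIf (EFst (EVar 0))
      (ECall (n + 1) [EDot (EVar 1) (EDot lexp (EDot rexp
        (EDot (ECall (n + 2) [lexp, EVar 1]) (ECall (n + 2) [rexp, EVar 1]))))])
      (ECall n [EDot (EVar 1) (ESnd (EVar 0))])"
    and h_Leaf: "\<And>v. h (Leaf v) = g x v"
    and h_Fork: "\<And>l r. h (Fork l r) = c x l r (h l) (h r)"
    and size: "\<And>t. size (enc t) \<le> s \<Longrightarrow> size (enc (h t)) \<le> b"
    and cost_Leaf: "\<And>v. size (enc (Leaf v)) \<le> s \<Longrightarrow> S (x, v) \<le> k"
    and cost_Fork: "\<And>l r. size (enc (Fork l r)) \<le> s \<Longrightarrow> T (x, (l, (r, (h l, h r)))) \<le> k"
  shows "size (enc t) \<le> s \<Longrightarrow>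
    \<exists>u \<le> size (enc t) * (k + 100 * s + 100 * size (enc x) + 100 * b + 500).
      eval (P @ [a, e, loop]) [enc t, enc x] loop (enc (h t)) u"
proof (induction t)
  case (Leaf v)
  let ?Q = "P @ [a, e, loop]"
  let ?l = "enc (Leaf v)"
  let ?arg = "1 + size (enc x) + (1 + size ?l + 1 + size ?l) + 1 + size (enc (x, v))"
  from computesE[OF g, where x = "(x, v)"] obtain t where t: "t \<le> S (x, v)"
    "eval P [enc (x, v)] a (enc (h (Leaf v))) t"
    unfolding h_Leaf fst_conv snd_conv .
  have "evals ?Q [?l, enc x] [EDot (EVar 1) (ESnd (EVar 0))] [enc (x, v)] (?arg + 0)"
    unfolding enc_simps(8)
    by (rule eval_evals.evals_Cons eval_evals.evals_Nil eval_evals.EDot eval_EVar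
        eval_eqI[OF eval_evals.ESnd[OF eval_EVar]] | simp)+
  moreover have "n < length ?Q" using n by simp
  moreover have "eval ?Q [enc (x, v)] (?Q ! n) (enc (h (Leaf v))) t"
    using eval_append[OF t(2), of "[a, e, loop]"] n by simp
  ultimately have "eval ?Q [?l, enc x] (ECall n [EDot (EVar 1) (ESnd (EVar 0))])
      (enc (h (Leaf v))) (?arg + 0 + t + 1)"
    by (rule eval_evals.ECall)
  moreover have "eval ?Q [?l, enc x] (EFst (EVar 0)) Atom (1 + size ?l + 1 + size ?l)"
    by (rule eval_eqI[OF eval_evals.EFst[OF eval_EVar]]) auto
  ultimately have "eval ?Q [?l, enc x] loop (enc (h (Leaf v)))
      (1 + size ?l + 1 + size ?l + (?arg + 0 + t + 1) + 1)"
    unfolding loop by (intro eval_evals.EIf_false)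
  moreover have "1 + size ?l + 1 + size ?l + (?arg + 0 + t + 1) + 1
      \<le> 1 * (k + 100 * s + 100 * size (enc x) + 100 * b + 500)"
    using Leaf cost_Leaf[of v] t(1) by simp
  moreover have "\<dots> \<le> size ?l * (k + 100 * s + 100 * size (enc x) + 100 * b + 500)"
    by (intro mult_le_mono1) simp
  ultimately show ?case by (meson le_trans)
next
  case (Fork l r)
  let ?Q = "P @ [a, e, loop]"
  let ?f = "enc (Fork l r)"
  let ?env = "[?f, enc x]"
  let ?K = "k + 100 * s + 100 * size (enc x) + 100 * b + 500"
  have s: "size (enc l) \<le> s" "size (enc r) \<le> s" using Fork.prems by simp_all
  from Fork.IH(1)[OF s(1)] obtain ul where ul: "ul \<le> size (enc l) * ?K"
    "eval ?Q [enc l, enc x] loop (enc (h l)) ul" by blast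
  from Fork.IH(2)[OF s(2)] obtain ur where ur: "ur \<le> size (enc r) * ?K"
    "eval ?Q [enc r, enc x] loop (enc (h r)) ur" by blast
  let ?z = "(x, (l, (r, (h l, h r))))"
  from computesE[OF c, where x = ?z] obtain t where t: "t \<le> T ?z"
    "eval P [enc ?z] e (enc (h (Fork l r))) t"
    unfolding h_Fork fst_conv snd_conv .
  let ?sub = "1 + size ?f + 1 + size ?f + 1 + size (Dot (enc l) (enc r))"
  have lexp: "eval ?Q ?env lexp (enc l) ?sub"
    unfolding left by (rule eval_eqI[OF eval_evals.EFst[OF eval_evals.ESnd[OF eval_EVar]]]) auto
  have rexp: "eval ?Q ?env rexp (enc r) ?sub"
    unfolding right by (rule eval_eqI[OF eval_evals.ESnd[OF eval_evals.ESnd[OF eval_EVar]]]) auto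
  have var: "eval ?Q ?env (EVar 1) (enc x) (1 + size (enc x))"
    by (rule eval_EVar) auto
  have Q: "n + 2 < length ?Q" "?Q ! (n + 2) = loop" "n + 1 < length ?Q" "?Q ! (n + 1) = e"
    using n by (simp_all add: nth_append)
  let ?rec = "\<lambda>u. ?sub + (1 + size (enc x) + 0) + u + 1"
  have recl: "eval ?Q ?env (ECall (n + 2) [lexp, EVar 1]) (enc (h l)) (?rec ul)"
    by (rule eval_evals.ECall[OF eval_evals.evals_Cons[OF lexp eval_evals.evals_Cons[OF var
            eval_evals.evals_Nil]] Q(1)])
      (use ul(2) Q(2) in simp)
  have recr: "eval ?Q ?env (ECall (n + 2) [rexp, EVar 1]) (enc (h r)) (?rec ur)"
    by (rule eval_evals.ECall[OF eval_evals.evals_Cons[OF rexp eval_evals.evals_Cons[OF var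
            eval_evals.evals_Nil]] Q(1)])
      (use ur(2) Q(2) in simp)
  let ?c1 = "?rec ul + ?rec ur + 1 + size (Dot (enc (h l)) (enc (h r)))"
  let ?c2 = "?sub + ?c1 + 1 + size (Dot (enc r) (Dot (enc (h l)) (enc (h r))))"
  let ?c3 = "?sub + ?c2 + 1 + size (Dot (enc l) (Dot (enc r) (Dot (enc (h l)) (enc (h r)))))"
  let ?c4 = "1 + size (enc x) + ?c3 + 1 +
    size (Dot (enc x) (Dot (enc l) (Dot (enc r) (Dot (enc (h l)) (enc (h r))))))"
  have "evals ?Q ?env [EDot (EVar 1) (EDot lexp (EDot rexp
        (EDot (ECall (n + 2) [lexp, EVar 1]) (ECall (n + 2) [rexp, EVar 1]))))] [enc ?z] (?c4 + 0)"
    unfolding enc_simps(8)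
    by (intro eval_evals.evals_Cons[OF _ eval_evals.evals_Nil] eval_evals.EDot var lexp rexp recl recr)
  moreover have "eval ?Q [enc ?z] (?Q ! (n + 1)) (enc (h (Fork l r))) t"
    unfolding Q(4) using t(2) by (rule eval_append)
  ultimately have "eval ?Q ?env (ECall (n + 1) [EDot (EVar 1) (EDot lexp (EDot rexp
        (EDot (ECall (n + 2) [lexp, EVar 1]) (ECall (n + 2) [rexp, EVar 1]))))])
      (enc (h (Fork l r))) (?c4 + 0 + t + 1)"
    using Q(3) by (intro eval_evals.ECall)
  moreover have "eval ?Q ?env (EFst (EVar 0)) (Dot Atom Atom) (1 + size ?f + 1 + size ?f)"
    by (rule eval_eqI[OF eval_evals.EFst[OF eval_EVar]]) auto
  ultimately have "eval ?Q ?env loop (enc (h (Fork l r)))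
      (1 + size ?f + 1 + size ?f + (?c4 + 0 + t + 1) + 1)"
    by (subst (2) loop) (rule eval_evals.EIf_true)
  moreover have "1 + size ?f + 1 + size ?f + (?c4 + 0 + t + 1) + 1 \<le> size ?f * ?K"
  proof -
    have f: "size ?f = size (enc l) + size (enc r) + 3" by simp
    have "t \<le> k" "size (enc (h l)) \<le> b" "size (enc (h r)) \<le> b"
      using t(1) cost_Fork[OF Fork.prems] size s le_trans by blast+
    then have "1 + size ?f + 1 + size ?f + (?c4 + 0 + t + 1) + 1 \<le> ul + ur + ?K"
      using Fork.prems by simp
    also have "\<dots> \<le> size (enc l) * ?K + size (enc r) * ?K + 3 * ?K"
      using ul(1) ur(1) by (intro add_mono) simp_all
    also have "\<dots> = size ?f * ?K"
      unfolding f by (simp only: distrib_right)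
    finally show ?thesis .
  qed
  ultimately show ?case by blast
qed

text \<open>The hypothesis \<open>size\<close> takes the place of a growth condition on
  \<open>c\<close>: a combination that runs in polynomial time could still square the size at every
  level.\<close>

lemma poly_time_layout_rec:
  fixes h :: "'a::enc \<Rightarrow> 'v::enc layout \<Rightarrow> 'b::enc"
  assumes g: "poly_time (\<lambda>z. g (fst z) (snd z))"
    and c: "poly_time (\<lambda>z. c (fst z) (fst (snd z)) (fst (snd (snd z)))
      (fst (snd (snd (snd z)))) (snd (snd (snd (snd z)))))"
    and h_Leaf: "\<And>x v. h x (Leaf v) = g x v"
    and h_Fork: "\<And>x l r. h x (Fork l r) = c x l r (h x l) (h x r)"
    and size: "poly_bounded (\<lambda>z. size (enc (h (fst z) (snd z))))"
  shows "poly_time (\<lambda>z. h (fst z) (snd z))"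
proof -
  from poly_time_common[OF g c] obtain P a e S T where
    g': "computes P a (\<lambda>z. g (fst z) (snd z)) S" and S: "poly_bounded S"
    and c': "computes P e (\<lambda>z. c (fst z) (fst (snd z)) (fst (snd (snd z)))
      (fst (snd (snd (snd z)))) (snd (snd (snd (snd z))))) T" and T: "poly_bounded T" .
  obtain p where p: "\<And>z. S z \<le> poly p (size (enc z))"
    using S unfolding poly_bounded_def by blast
  obtain q where q: "\<And>z. T z \<le> poly q (size (enc z))"
    using T unfolding poly_bounded_def by blast
  obtain d where d: "\<And>z. size (enc (h (fst z) (snd z))) \<le> poly d (size (enc z))"
    using size unfolding poly_bounded_def by blast
  define n where "n = length P"
  define lexp where "lexp = EFst (ESnd (EVar 0))"
  define rexp where "rexp = ESnd (ESnd (EVar 0))"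
  define loop where "loop = EIf (EFst (EVar 0))
      (ECall (n + 1) [EDot (EVar 1) (EDot lexp (EDot rexp
        (EDot (ECall (n + 2) [lexp, EVar 1]) (ECall (n + 2) [rexp, EVar 1]))))])
      (ECall n [EDot (EVar 1) (ESnd (EVar 0))])"
  define b where "b z = poly d (size (enc z))" for z :: "'a \<times> 'v layout"
  define k where "k z = poly p (size (enc z)) + poly q (size (enc z) + 5 + 2 * b z)"
    for z :: "'a \<times> 'v layout"
  define U where "U z = size (enc (snd z)) *
      (k z + 100 * size (enc (snd z)) + 100 * size (enc (fst z)) + 100 * b z + 500)"
    for z :: "'a \<times> 'v layout"
  define R where "R = P @ [a, e, loop]"
  have run: "\<exists>u \<le> U (x, t). eval R [enc t, enc x] loop (enc (h x t)) u" for x t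
  proof -
    have bound: "size (enc (h x t')) \<le> b (x, t)" if "size (enc t') \<le> size (enc t)" for t'
    proof -
      have "size (enc (h x t')) \<le> poly d (size (enc (x, t')))" using d[of "(x, t')"] by simp
      also have "\<dots> \<le> b (x, t)" unfolding b_def by (rule poly_nat_mono) (use that in simp)
      finally show ?thesis .
    qed
    have leaf: "S (x, v) \<le> k (x, t)" if "size (enc (Leaf v)) \<le> size (enc t)" for v
    proof -
      have "poly p (size (enc (x, v))) \<le> poly p (size (enc (x, t)))"
        by (rule poly_nat_mono) (use that in simp)
      with p[of "(x, v)"] show ?thesis unfolding k_def by simp
    qed
    have fork: "T (x, (l, (r, (h x l, h x r)))) \<le> k (x, t)"
      if "size (enc (Fork l r)) \<le> size (enc t)" for l r
    proof -
      have "size (enc (h x l)) \<le> b (x, t)" "size (enc (h x r)) \<le> b (x, t)"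
        using that by (auto intro!: bound)
      then have "poly q (size (enc (x, (l, (r, (h x l, h x r))))))
          \<le> poly q (size (enc (x, t)) + 5 + 2 * b (x, t))"
        by (intro poly_nat_mono) (use that in simp)
      with q[of "(x, (l, (r, (h x l, h x r))))"] show ?thesis unfolding k_def by linarith
    qed
    from eval_layout_rec[where h = "h x" and s = "size (enc t)" and t = t, OF g' c' n_def
        lexp_def rexp_def loop_def h_Leaf h_Fork bound leaf fork order_refl]
    show ?thesis unfolding U_def R_def fst_conv snd_conv .
  qed
  have "computes R (ECall (n + 2) [ESnd (EVar 0), EFst (EVar 0)]) (\<lambda>z. h (fst z) (snd z))
      (\<lambda>z. 4 * size (enc z) + 5 + U z)"
    unfolding computes_def
  proof
    fix z :: "'a \<times> 'v layout"
    obtain x t where z: "z = (x, t)" by (cases z)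
    from run obtain u where u: "u \<le> U (x, t)" "eval R [enc t, enc x] loop (enc (h x t)) u"
      by blast
    let ?s = "1 + size (enc z) + 1 + size (enc z)"
    have "eval R [enc z] (ESnd (EVar 0)) (enc t) ?s"
      by (rule eval_eqI[OF eval_evals.ESnd[OF eval_EVar]]) (auto simp: z)
    moreover have "eval R [enc z] (EFst (EVar 0)) (enc x) ?s"
      by (rule eval_eqI[OF eval_evals.EFst[OF eval_EVar]]) (auto simp: z)
    ultimately have "evals R [enc z] [ESnd (EVar 0), EFst (EVar 0)] [enc t, enc x] (?s + (?s + 0))"
      by (intro eval_evals.evals_Cons eval_evals.evals_Nil)
    moreover have "n + 2 < length R" by (simp add: R_def n_def)
    moreover have "eval R [enc t, enc x] (R ! (n + 2)) (enc (h x t)) u"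
      using u(2) by (simp add: R_def n_def nth_append)
    ultimately have "eval R [enc z] (ECall (n + 2) [ESnd (EVar 0), EFst (EVar 0)])
        (enc (h x t)) (?s + (?s + 0) + u + 1)"
      by (rule eval_evals.ECall)
    moreover have "?s + (?s + 0) + u + 1 \<le> 4 * size (enc z) + 5 + U z"
      using u(1) unfolding z by simp
    ultimately show "\<exists>t\<le>4 * size (enc z) + 5 + U z.
        eval R [enc z] (ECall (n + 2) [ESnd (EVar 0), EFst (EVar 0)]) (enc (h (fst z) (snd z))) t"
      unfolding z fst_conv snd_conv by blast
  qed
  moreover have "poly_bounded (\<lambda>z. 4 * size (enc z) + 5 + U z)"
    unfolding U_def k_def b_def
    by (intro poly_bounded_intros poly_bounded_poly poly_time_size poly_time_intros)
  ultimately show ?thesis by (rule poly_timeI)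
qed

section \<open>List operations in polynomial time\<close>

lemma poly_time_Cons [poly_time_intros]:
  "poly_time f \<Longrightarrow> poly_time g \<Longrightarrow> poly_time (\<lambda>x. f x # g x)"
  by (rule poly_time_same_enc[OF poly_time_Pair[of f g]]) auto

lemma poly_time_Suc [poly_time_intros]: "poly_time f \<Longrightarrow> poly_time (\<lambda>x. Suc (f x))"
  by (rule poly_time_same_enc[OF poly_time_Pair[OF poly_time_const[of "()"]]]) auto

lemma poly_time_pred [poly_time_intros]: "poly_time f \<Longrightarrow> poly_time (\<lambda>x. f x - Suc 0)"
proof (rule poly_time_compose[where g = "\<lambda>n. n - Suc 0"], rule poly_time_ESnd)
  show "enc (n - Suc 0) = dsnd (enc n)" for n by (cases n) auto
qed

lemma poly_time_tl [poly_time_intros]: "poly_time f \<Longrightarrow> poly_time (\<lambda>x. tl (f x))"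
proof (rule poly_time_compose[where g = tl], rule poly_time_ESnd)
  show "enc (tl xs) = dsnd (enc xs)" for xs :: "'b list" by (cases xs) auto
qed

lemma poly_time_eq_0 [poly_time_intros]:
  assumes "poly_time f"
  shows "poly_time (\<lambda>x. f x = (0::nat))"
proof (rule poly_time_branch[OF assms poly_time_const[of False] poly_time_const[of True]])
  show "(f x = 0) = (if enc (f x) = Atom then True else False)" for x by (cases "f x") auto
qed

lemma poly_time_not [poly_time_intros]: "poly_time f \<Longrightarrow> poly_time (\<lambda>x. \<not> f x)"
  using poly_time_if[of f "\<lambda>_. False" "\<lambda>_. True"] by (simp add: poly_time_const if_bool_eq_conj)

lemma poly_time_conj [poly_time_intros]:
  assumes "poly_time f" "poly_time g"
  shows "poly_time (\<lambda>x. f x \<and> g x)"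
proof (rule poly_time_branch[OF assms poly_time_const[of False]])
  show "(f x \<and> g x) = (if enc (f x) = Atom then False else g x)" for x by (cases "f x") auto
qed

lemma poly_time_iff [poly_time_intros]:
  assumes "poly_time f" "poly_time g"
  shows "poly_time (\<lambda>x. f x = (g x :: bool))"
proof -
  have "poly_time (\<lambda>x. if f x then g x else \<not> g x)" by (intro poly_time_intros assms)
  moreover have "(\<lambda>x. if f x then g x else \<not> g x) = (\<lambda>x. f x = g x)" by auto
  ultimately show ?thesis by simp
qed

text \<open>\<open>EFst\<close> maps \<open>Atom\<close> to \<open>Atom\<close>, so it computes the
  head of a list with a default whose encoding is \<open>Atom\<close>, such as \<open>False\<close>
  or the empty list.\<close>

definition hd_or :: "'a \<Rightarrow> 'a list \<Rightarrow> 'a" where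
  "hd_or d xs = (case xs of [] \<Rightarrow> d | x # _ \<Rightarrow> x)"

lemma poly_time_hd_or:
  assumes "enc d = Atom" "poly_time f"
  shows "poly_time (\<lambda>x. hd_or d (f x))"
proof (rule poly_time_compose[where g = "hd_or d"], rule poly_time_EFst)
  show "enc (hd_or d xs) = dfst (enc xs)" for xs by (cases xs) (auto simp: hd_or_def assms(1))
qed fact

lemma poly_time_rev [poly_time_intros]:
  assumes "poly_time f"
  shows "poly_time (\<lambda>x. rev (f x))"
proof -
  have "poly_time (\<lambda>x. fold (\<lambda>y ys. y # ys) (f x) [])"
    by (rule poly_time_fold[where D = "\<lambda>x y. size (enc y) + 1"])
      (intro poly_time_intros assms poly_bounded_intros poly_time_size | simp)+
  then show ?thesis by (simp add: fold_Cons_rev)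
qed

lemma poly_time_append [poly_time_intros]:
  assumes "poly_time f" "poly_time g"
  shows "poly_time (\<lambda>x. f x @ g x)"
proof -
  have "poly_time (\<lambda>x. fold (\<lambda>y ys. y # ys) (rev (f x)) (g x))"
    by (rule poly_time_fold[where D = "\<lambda>x y. size (enc y) + 1"])
      (intro poly_time_intros assms poly_bounded_intros poly_time_size | simp)+
  then show ?thesis by (simp add: fold_Cons_rev)
qed

lemma poly_time_map [poly_time_intros]:
  assumes f: "poly_time (\<lambda>z. f (fst z) (snd z))" and L: "poly_time L"
  shows "poly_time (\<lambda>x. map (f x) (L x))"
proof -
  have *: "poly_time (\<lambda>z. f (fst z) (fst (snd z)))"
    using poly_time_compose[OF f, of "\<lambda>z. (fst z, fst (snd z))"] by (simp add: poly_time_intros)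
  have "poly_time (\<lambda>x. fold (\<lambda>y ys. f x y # ys) (rev (L x)) [])"
    by (rule poly_time_fold[where D = "\<lambda>x y. size (enc (f x y)) + 1"])
      (intro poly_time_intros * f L poly_bounded_intros poly_time_size | simp)+
  moreover have "fold (\<lambda>y ys. f x y # ys) (rev xs) [] = map (f x) xs" for x xs
    by (induction xs) simp_all
  ultimately show ?thesis by simp
qed

lemma poly_time_filter [poly_time_intros]:
  assumes f: "poly_time (\<lambda>z. f (fst z) (snd z))" and L: "poly_time L"
  shows "poly_time (\<lambda>x. filter (f x) (L x))"
proof -
  have *: "poly_time (\<lambda>z. f (fst z) (fst (snd z)))"
    using poly_time_compose[OF f, of "\<lambda>z. (fst z, fst (snd z))"] by (simp add: poly_time_intros)
  have "poly_time (\<lambda>x. fold (\<lambda>y ys. if f x y then y # ys else ys) (rev (L x)) [])"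
    by (rule poly_time_fold[where D = "\<lambda>x y. size (enc y) + 1"])
      (intro poly_time_intros * L poly_bounded_intros poly_time_size | simp)+
  moreover have "fold (\<lambda>y ys. if f x y then y # ys else ys) (rev xs) [] = filter (f x) xs" for x xs
    by (induction xs) simp_all
  ultimately show ?thesis by simp
qed

lemma poly_time_concat [poly_time_intros]:
  assumes L: "poly_time L"
  shows "poly_time (\<lambda>x. concat (L x))"
proof -
  have "poly_time (\<lambda>x. fold (\<lambda>ys acc. ys @ acc) (rev (L x)) [])"
    by (rule poly_time_fold[where D = "\<lambda>x y. size (enc y)"])
      (intro poly_time_intros L poly_bounded_intros poly_time_size | simp)+
  moreover have "fold (\<lambda>ys acc. ys @ acc) (rev xss) [] = concat xss" for xss :: "'b list list"
    by (induction xss) simp_all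
  ultimately show ?thesis by simp
qed

lemma poly_time_list_all [poly_time_intros]:
  assumes f: "poly_time (\<lambda>z. f (fst z) (snd z))" and L: "poly_time L"
  shows "poly_time (\<lambda>x. list_all (f x) (L x))"
proof -
  have *: "poly_time (\<lambda>z. f (fst z) (fst (snd z)))"
    using poly_time_compose[OF f, of "\<lambda>z. (fst z, fst (snd z))"] by (simp add: poly_time_intros)
  have "poly_time (\<lambda>x. fold (\<lambda>y b. f x y \<and> b) (rev (L x)) True)"
    by (rule poly_time_fold[where D = "\<lambda>x y. 1"])
      (intro poly_time_intros * L poly_bounded_intros poly_time_size trans_le_add2 size_enc_bool_le)+
  moreover have "fold (\<lambda>y b. f x y \<and> b) (rev xs) True = list_all (f x) xs" for x xs
    by (induction xs) simp_all
  ultimately show ?thesis by simp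
qed

lemma poly_time_list_ex [poly_time_intros]:
  assumes f: "poly_time (\<lambda>z. f (fst z) (snd z))" and L: "poly_time L"
  shows "poly_time (\<lambda>x. list_ex (f x) (L x))"
  using poly_time_not[OF poly_time_list_all[OF poly_time_not[OF f] L]]
  by (simp add: list_all_iff list_ex_iff)

lemma poly_time_length [poly_time_intros]:
  assumes "poly_time L"
  shows "poly_time (\<lambda>x. length (L x))"
proof -
  have "poly_time (\<lambda>x. fold (\<lambda>_ n. Suc n) (L x) 0)"
    by (rule poly_time_fold[where D = "\<lambda>x y. 1"])
      (intro poly_time_intros assms poly_bounded_intros | simp)+
  moreover have "fold (\<lambda>_ n. Suc n) xs k = length xs + k" for xs :: "'b list" and k
    by (induction xs arbitrary: k) simp_all
  ultimately show ?thesis by simp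
qed

lemma poly_time_take_1 [poly_time_intros]:
  assumes "poly_time L"
  shows "poly_time (\<lambda>x. take 1 (L x))"
proof -
  have "poly_time (\<lambda>x. fold (\<lambda>y _. [y]) (rev (L x)) [])"
    by (rule poly_time_fold[where D = "\<lambda>x y. size (enc y) + 1"])
      (intro poly_time_intros assms poly_bounded_intros poly_time_size | simp)+
  moreover have "fold (\<lambda>y _. [y]) (rev xs) [] = take 1 xs" for xs :: "'b list"
    by (cases xs) simp_all
  ultimately show ?thesis by simp
qed

text \<open>A unary number and a list of that many units have the same encoding, so a number can
  drive a fold as a loop counter.\<close>

lemma poly_time_replicate_unit: "poly_time f \<Longrightarrow> poly_time (\<lambda>x. replicate (f x) ())"
proof (erule poly_time_same_enc)
  have "enc (replicate n ()) = enc n" for n by (induction n) auto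
  then show "enc (replicate (f x) ()) = enc (f x)" for x .
qed

lemma poly_time_drop [poly_time_intros]:
  assumes "poly_time f" "poly_time L"
  shows "poly_time (\<lambda>x. drop (f x) (L x))"
proof -
  have "poly_time (\<lambda>x. fold (\<lambda>_ xs. tl xs) (replicate (f x) ()) (L x))"
  proof (rule poly_time_fold[where D = "\<lambda>x y. 0"])
    show "size (enc (tl xs)) \<le> size (enc xs) + 0" for xs :: "'b list" by (cases xs) auto
  qed (intro poly_time_intros poly_time_replicate_unit assms poly_bounded_intros)+
  moreover have "fold (\<lambda>_ xs. tl xs) (replicate n ()) xs = drop n xs" for n and xs :: "'b list"
    by (induction n arbitrary: xs) (simp_all add: drop_Suc)
  ultimately show ?thesis by simp
qed

lemma poly_time_diff:
  assumes "poly_time f" "poly_time g"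
  shows "poly_time (\<lambda>x. f x - g x :: nat)"
proof -
  have "poly_time (\<lambda>x. fold (\<lambda>_ n. n - Suc 0) (replicate (g x) ()) (f x))"
  proof (rule poly_time_fold[where D = "\<lambda>x y. 0"])
    show "size (enc (n - Suc 0)) \<le> size (enc n) + 0" for n by (cases n) auto
  qed (intro poly_time_intros poly_time_replicate_unit assms poly_bounded_intros)+
  moreover have "fold (\<lambda>_ n. n - Suc 0) (replicate m ()) n = n - m" for m n
    by (induction m arbitrary: n) simp_all
  ultimately show ?thesis by simp
qed

lemma poly_time_le [poly_time_intros]:
  assumes "poly_time f" "poly_time g"
  shows "poly_time (\<lambda>x. f x \<le> (g x :: nat))"
  using poly_time_eq_0[OF poly_time_diff[OF assms]] by simp

lemma poly_time_nat_eq [poly_time_intros]: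
  assumes "poly_time f" "poly_time g"
  shows "poly_time (\<lambda>x. f x = (g x :: nat))"
  unfolding order_eq_iff by (intro poly_time_intros assms)

lemma poly_time_leaf_list [poly_time_intros]:
  assumes "poly_time f"
  shows "poly_time (\<lambda>x. leaf_list (f x))"
proof -
  have bound: "size (enc (leaf_list t)) \<le> size (enc t)" for t :: "'b layout"
    by (induction t) auto
  have "poly_time (\<lambda>z :: unit \<times> 'b layout. leaf_list (snd z))"
  proof (rule poly_time_layout_rec[where h = "\<lambda>_. leaf_list" and g = "\<lambda>_ v. [v]"
        and c = "\<lambda>_ l r xs ys. xs @ ys"])
    show "poly_bounded (\<lambda>z :: unit \<times> 'b layout. size (enc (leaf_list (snd z))))"
      by (rule poly_bounded_mono[OF poly_bounded_size]) (simp add: bound enc_prod_def trans_le_add2 le_SucI)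
  qed (intro poly_time_intros | simp)+
  from poly_time_compose[OF this, of "\<lambda>x. ((), f x)"] show ?thesis
    by (simp add: poly_time_intros assms)
qed

section \<open>The dynamic program\<close>

text \<open>Lets a definition be analysed once, on projections of a tuple, and yields a closure rule
  for arbitrary argument functions. The next two lemmas do the same for more arguments.\<close>

lemma poly_time_lift2:
  assumes "poly_time (\<lambda>z. F (fst z) (snd z))" "poly_time f" "poly_time g"
  shows "poly_time (\<lambda>x. F (f x) (g x))"
  using poly_time_compose[OF assms(1) poly_time_Pair[OF assms(2,3)]] by simp

lemma poly_time_lift3:
  assumes "poly_time (\<lambda>z. F (fst z) (fst (snd z)) (snd (snd z)))"
    "poly_time f" "poly_time g" "poly_time h"
  shows "poly_time (\<lambda>x. F (f x) (g x) (h x))"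
  using poly_time_compose[OF assms(1) poly_time_Pair[OF assms(2) poly_time_Pair[OF assms(3,4)]]] by simp

lemma poly_time_lift4:
  assumes "poly_time (\<lambda>z. F (fst z) (fst (snd z)) (fst (snd (snd z))) (snd (snd (snd z))))"
    "poly_time f" "poly_time g" "poly_time h" "poly_time k"
  shows "poly_time (\<lambda>x. F (f x) (g x) (h x) (k x))"
  using poly_time_compose[OF assms(1) poly_time_Pair[OF assms(2) poly_time_Pair[OF assms(3)
    poly_time_Pair[OF assms(4,5)]]]] by simp

text \<open>
  One side of the polar partition below a tree node. The second list is the clique that may still be
  extended outside the subtree; \<open>close\<close> gives up this option. In a pair of halves, the first one
  refers to adjacency, the second one to non-adjacency.
\<close>

type_synonym half = "nat list \<times> nat list"

text \<open>Entries outside the matrix count as non-adjacent. So \<open>adj\<close> agrees with the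
  arc relation on all numbers, and its symmetry needs no range condition.\<close>

definition adj :: "bool list list \<Rightarrow> nat \<Rightarrow> nat \<Rightarrow> bool" where
  "adj M u v = hd_or False (drop v (hd_or [] (drop u M)))"

text \<open>Only the two open cliques are linked, and they must be linked completely, as they become
  one clique. Every condition is a complete or an empty adjacency between two lists.\<close>

definition compat :: "bool list list \<Rightarrow> bool \<Rightarrow> half \<Rightarrow> half \<Rightarrow> bool" where
  "compat M b h h' \<longleftrightarrow>
     list_all (\<lambda>x. list_all (\<lambda>y. adj M x y = b) (snd h') \<and>
                    list_all (\<lambda>y. adj M x y \<noteq> b) (fst h')) (snd h) \<and>
     list_all (\<lambda>x. list_all (\<lambda>y. adj M x y \<noteq> b) (fst h' @ snd h')) (fst h)"

definition merge :: "half \<Rightarrow> half \<Rightarrow> half" where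
  "merge h h' = (fst h @ fst h', snd h @ snd h')"

definition close :: "half \<Rightarrow> half" where
  "close h = (fst h @ snd h, [])"

text \<open>The four results are the independent choices, for each half, of keeping the merged
  clique open or finishing it.\<close>

definition joins :: "bool list list \<Rightarrow> half \<times> half \<Rightarrow> half \<times> half \<Rightarrow> (half \<times> half) list" where
  "joins M p q =
     (if compat M True (fst p) (fst q) \<and> compat M False (snd p) (snd q)
      then [(merge (fst p) (fst q), merge (snd p) (snd q)),
            (close (merge (fst p) (fst q)), merge (snd p) (snd q)),
            (merge (fst p) (fst q), close (merge (snd p) (snd q))),
            (close (merge (fst p) (fst q)), close (merge (snd p) (snd q)))]
      else [])"

definition all_joins ::
  "bool list list \<Rightarrow> (half \<times> half) list \<Rightarrow> (half \<times> half) list \<Rightarrow> (half \<times> half) list" where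
  "all_joins M P Q = concat (map (\<lambda>p. concat (map (joins M p) Q)) P)"

definition leaf_candidates :: "nat \<Rightarrow> (half \<times> half) list" where
  "leaf_candidates v = [(([], []), ([], [])), (([v], []), ([], [])), (([], [v]), ([], [])),
     (([], []), ([v], [])), (([], []), ([], [v]))]"

definition covered :: "half \<times> half \<Rightarrow> nat list" where
  "covered p = (fst (fst p) @ snd (fst p)) @ (fst (snd p) @ snd (snd p))"

text \<open>The result is a list with at most one entry, which serves as an optional value and is
  empty when \<open>P\<close> is.\<close>

definition largest :: "(half \<times> half) list \<Rightarrow> (half \<times> half) list" where
  "largest P =
     take 1 (filter (\<lambda>p. list_all (\<lambda>q. length (covered q) \<le> length (covered p)) P) P)"

text \<open>The universal test compares common neighbourhoods, the existential one unions of
  neighbourhoods. In the complement the two exchange roles, so the same test fits both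
  halves.\<close>

definition same_neighbours :: "bool list list \<Rightarrow> nat list \<Rightarrow> nat list \<Rightarrow> nat list \<Rightarrow> bool" where
  "same_neighbours M W X Y \<longleftrightarrow>
     list_all (\<lambda>w. list_all (\<lambda>x. adj M x w) X = list_all (\<lambda>x. adj M x w) Y \<and>
                    list_ex (\<lambda>x. adj M x w) X = list_ex (\<lambda>x. adj M x w) Y) W"

definition similar :: "bool list list \<Rightarrow> nat list \<Rightarrow> half \<times> half \<Rightarrow> half \<times> half \<Rightarrow> bool" where
  "similar M W p q \<longleftrightarrow>
     same_neighbours M W (fst (fst p)) (fst (fst q)) \<and>
     same_neighbours M W (snd (fst p)) (snd (fst q)) \<and>
     same_neighbours M W (fst (snd p)) (fst (snd q)) \<and>
     same_neighbours M W (snd (snd p)) (snd (snd q))"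

definition all_pairs :: "'a list \<Rightarrow> ('a \<times> 'a) list" where
  "all_pairs xs = concat (map (\<lambda>a. map (\<lambda>b. (a, b)) xs) xs)"

text \<open>At least one key for each class of partial solutions with the same neighbourhoods outside the subtree.\<close>

definition keys :: "nat list \<Rightarrow> (half \<times> half) list" where
  "keys L = all_pairs (all_pairs ([] # map (\<lambda>z. [fst z, snd z]) (all_pairs L)))"

text \<open>Selecting by keys bounds the length of the result by the number of keys, whatever
  \<open>P\<close> is. Equivalent keys may select the same entry repeatedly, which is
  harmless.\<close>

definition prune ::
  "bool list list \<Rightarrow> nat list \<Rightarrow> (half \<times> half) list \<Rightarrow> (half \<times> half) list \<Rightarrow> (half \<times> half) list" where
  "prune M W ks P = concat (map (\<lambda>k. largest (filter (similar M W k) P)) ks)"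

definition outside :: "nat list \<Rightarrow> nat list \<Rightarrow> nat list" where
  "outside V L = filter (\<lambda>w. \<not> list_ex (\<lambda>v. v = w) L) V"

text \<open>The parameter is the adjacency matrix together with the list of all leaves of the whole
  tree, which is needed to know what lies outside a subtree.\<close>

fun candidates :: "bool list list \<times> nat list \<Rightarrow> nat layout \<Rightarrow> (half \<times> half) list" where
  "candidates x (Leaf v) = leaf_candidates v"
| "candidates x (Fork l r) =
     prune (fst x) (outside (snd x) (leaf_list l @ leaf_list r)) (keys (leaf_list l @ leaf_list r))
       (all_joins (fst x) (candidates x l) (candidates x r))"

definition polar_subset :: "bool list list \<times> nat layout \<Rightarrow> nat list" where
  "polar_subset z = concat (map covered (largest (candidates (fst z, leaf_list (snd z)) (snd z))))"

lemma poly_time_adj [poly_time_intros]: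
  "poly_time f \<Longrightarrow> poly_time g \<Longrightarrow> poly_time h \<Longrightarrow> poly_time (\<lambda>x. adj (f x) (g x) (h x))"
  unfolding adj_def by (intro poly_time_intros poly_time_hd_or enc_simps)

lemma poly_time_compat [poly_time_intros]:
  "poly_time f \<Longrightarrow> poly_time g \<Longrightarrow> poly_time h \<Longrightarrow> poly_time k \<Longrightarrow> poly_time (\<lambda>x. compat (f x) (g x) (h x) (k x))"
  by (rule poly_time_lift4[where F = compat]) (unfold compat_def, intro poly_time_intros)

lemma poly_time_merge [poly_time_intros]:
  "poly_time f \<Longrightarrow> poly_time g \<Longrightarrow> poly_time (\<lambda>x. merge (f x) (g x))"
  by (rule poly_time_lift2[where F = merge]) (unfold merge_def, intro poly_time_intros)

lemma poly_time_close [poly_time_intros]: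
  "poly_time f \<Longrightarrow> poly_time (\<lambda>x. close (f x))"
  by (rule poly_time_compose[where g = close]) (unfold close_def, intro poly_time_intros)

lemma poly_time_joins [poly_time_intros]:
  "poly_time f \<Longrightarrow> poly_time g \<Longrightarrow> poly_time h \<Longrightarrow> poly_time (\<lambda>x. joins (f x) (g x) (h x))"
  by (rule poly_time_lift3[where F = joins]) (unfold joins_def, intro poly_time_intros)

lemma poly_time_all_joins [poly_time_intros]:
  "poly_time f \<Longrightarrow> poly_time g \<Longrightarrow> poly_time h \<Longrightarrow> poly_time (\<lambda>x. all_joins (f x) (g x) (h x))"
  by (rule poly_time_lift3[where F = all_joins]) (unfold all_joins_def, intro poly_time_intros)

lemma poly_time_leaf_candidates [poly_time_intros]:
  "poly_time f \<Longrightarrow> poly_time (\<lambda>x. leaf_candidates (f x))"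
  by (rule poly_time_compose[where g = leaf_candidates]) (unfold leaf_candidates_def, intro poly_time_intros)

lemma poly_time_covered [poly_time_intros]:
  "poly_time f \<Longrightarrow> poly_time (\<lambda>x. covered (f x))"
  by (rule poly_time_compose[where g = covered]) (unfold covered_def, intro poly_time_intros)

lemma poly_time_largest [poly_time_intros]:
  "poly_time f \<Longrightarrow> poly_time (\<lambda>x. largest (f x))"
  by (rule poly_time_compose[where g = largest]) (unfold largest_def, intro poly_time_intros)

lemma poly_time_same_neighbours [poly_time_intros]:
  "poly_time f \<Longrightarrow> poly_time g \<Longrightarrow> poly_time h \<Longrightarrow> poly_time k \<Longrightarrow> poly_time (\<lambda>x. same_neighbours (f x) (g x) (h x) (k x))"
  by (rule poly_time_lift4[where F = same_neighbours]) (unfold same_neighbours_def, intro poly_time_intros)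

lemma poly_time_similar [poly_time_intros]:
  "poly_time f \<Longrightarrow> poly_time g \<Longrightarrow> poly_time h \<Longrightarrow> poly_time k \<Longrightarrow> poly_time (\<lambda>x. similar (f x) (g x) (h x) (k x))"
  by (rule poly_time_lift4[where F = similar]) (unfold similar_def, intro poly_time_intros)

lemma poly_time_all_pairs [poly_time_intros]:
  "poly_time f \<Longrightarrow> poly_time (\<lambda>x. all_pairs (f x))"
  by (rule poly_time_compose[where g = all_pairs]) (unfold all_pairs_def, intro poly_time_intros)

lemma poly_time_keys [poly_time_intros]:
  "poly_time f \<Longrightarrow> poly_time (\<lambda>x. keys (f x))"
  by (rule poly_time_compose[where g = keys]) (unfold keys_def, intro poly_time_intros)

lemma poly_time_prune [poly_time_intros]:
  "poly_time f \<Longrightarrow> poly_time g \<Longrightarrow> poly_time h \<Longrightarrow> poly_time k \<Longrightarrow> poly_time (\<lambda>x. prune (f x) (g x) (h x) (k x))"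
  by (rule poly_time_lift4[where F = prune]) (unfold prune_def, intro poly_time_intros)

lemma poly_time_outside [poly_time_intros]:
  "poly_time f \<Longrightarrow> poly_time g \<Longrightarrow> poly_time (\<lambda>x. outside (f x) (g x))"
  by (rule poly_time_lift2[where F = outside]) (unfold outside_def, intro poly_time_intros)

section \<open>Polynomial bounds on the lists of candidates\<close>

lemma size_enc_list_le:
  assumes "\<And>x. x \<in> set xs \<Longrightarrow> size (enc x) \<le> b"
  shows "size (enc xs) \<le> length xs * (b + 1)"
  using assms by (induction xs) force+

lemma set_largest_subset: "set (largest P) \<subseteq> set P"
  unfolding largest_def by (rule subset_trans[OF set_take_subset]) simp

lemma set_prune_subset: "set (prune M W ks P) \<subseteq> set P"
  using set_largest_subset by (fastforce simp: prune_def)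

lemma length_all_pairs: "length (all_pairs xs) = length xs * length xs"
  by (simp add: all_pairs_def length_concat o_def sum_list_triv)

lemma length_keys: "length (keys L) = (length L * length L + 1) ^ 4"
  by (simp add: keys_def length_all_pairs power4_eq_xxxx algebra_simps)

lemma length_largest_le: "length (largest P) \<le> 1"
  by (simp add: largest_def)

lemma length_prune_le: "length (prune M W ks P) \<le> length ks"
proof -
  have "length (prune M W ks P) = (\<Sum>k\<leftarrow>ks. length (largest (filter (similar M W k) P)))"
    by (simp add: prune_def length_concat o_def)
  also have "\<dots> \<le> (\<Sum>k\<leftarrow>ks. 1)"
    by (intro sum_list_mono length_largest_le)
  finally show ?thesis by (simp add: sum_list_triv)
qed

lemma in_all_joins:
  "r \<in> set (all_joins M P Q) \<longleftrightarrow> (\<exists>p \<in> set P. \<exists>q \<in> set Q. r \<in> set (joins M p q))"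
  by (auto simp: all_joins_def)

lemma size_covered_joins:
  assumes "r \<in> set (joins M p q)"
  shows "size (enc (covered r)) = size (enc (covered p)) + size (enc (covered q))"
  using assms by (auto simp: joins_def covered_def merge_def close_def split: if_splits)

text \<open>Joining merely regroups the vertices, so the encoded sizes of the vertex lists add up
  along the tree, just as those of the leaves do.\<close>

lemma size_covered_candidates:
  "p \<in> set (candidates x t) \<Longrightarrow> size (enc (covered p)) \<le> size (enc t)"
proof (induction t arbitrary: p)
  case (Leaf v)
  then show ?case by (auto simp: leaf_candidates_def covered_def)
next
  case (Fork l r)
  from Fork.prems set_prune_subset obtain q q' where
    "q \<in> set (candidates x l)" "q' \<in> set (candidates x r)" "p \<in> set (joins (fst x) q q')"
    by (fastforce simp: in_all_joins)
  with Fork.IH show ?case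
    by (fastforce simp: size_covered_joins)
qed

lemma length_candidates: "length (candidates x t) \<le> (length (leaf_list t) * length (leaf_list t) + 1) ^ 4"
proof (cases t)
  case (Leaf v)
  \<comment> \<open>A leaf has 5 candidates, and the bound is
    \<open>(1 * 1 + 1) ^ 4 = 16\<close>.\<close>
  then show ?thesis by (simp add: leaf_candidates_def eval_nat_numeral)
next
  case (Fork l r)
  have "length (candidates x t) \<le> length (keys (leaf_list t))"
    unfolding Fork candidates.simps leaf_list.simps by (rule length_prune_le)
  then show ?thesis unfolding length_keys .
qed

lemma length_leaf_list_le: "length (leaf_list t) \<le> size (enc t)"
  by (induction t) auto

lemma size_candidates:
  "size (enc (candidates x t)) \<le> (size (enc t) * size (enc t) + 1) ^ 4 * (size (enc t) + 4)"
proof -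
  \<comment> \<open>The 3 counts the pair constructors that hold the four lists of \<open>p\<close>
    together.\<close>
  have "size (enc p) \<le> size (enc t) + 3" if "p \<in> set (candidates x t)" for p
    using size_covered_candidates[OF that] by (cases p) (auto simp: covered_def enc_prod_def)
  then have "size (enc (candidates x t)) \<le> length (candidates x t) * (size (enc t) + 3 + 1)"
    by (rule size_enc_list_le)
  also have "\<dots> \<le> (size (enc t) * size (enc t) + 1) ^ 4 * (size (enc t) + 4)"
  proof (rule mult_le_mono)
    have "length (leaf_list t) * length (leaf_list t) + 1 \<le> size (enc t) * size (enc t) + 1"
      by (intro add_mono mult_le_mono length_leaf_list_le order_refl)
    with length_candidates[of x t] show "length (candidates x t) \<le> (size (enc t) * size (enc t) + 1) ^ 4"
      by (meson le_trans power_mono zero_le)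
  qed simp
  finally show ?thesis .
qed

lemma poly_time_candidates [poly_time_intros]:
  assumes "poly_time f" "poly_time g"
  shows "poly_time (\<lambda>x. candidates (f x) (g x))"
proof (rule poly_time_lift2[where F = candidates, OF _ assms],
    rule poly_time_layout_rec[where g = "\<lambda>_. leaf_candidates" and c = "\<lambda>x l r P Q.
      prune (fst x) (outside (snd x) (leaf_list l @ leaf_list r)) (keys (leaf_list l @ leaf_list r))
       (all_joins (fst x) P Q)"])
  show "poly_bounded (\<lambda>z. size (enc (candidates (fst z) (snd z))))"
    by (rule poly_bounded_mono[OF _ size_candidates], unfold power4_eq_xxxx)
      (intro poly_bounded_intros poly_time_size poly_time_intros)
qed (simp_all, intro poly_time_intros, intro poly_time_intros)

lemma poly_time_polar_subset: "poly_time polar_subset"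
  unfolding polar_subset_def by (intro poly_time_intros)

section \<open>Cliques crossing a chain cut\<close>

text \<open>Cluster graphs are the graphs without an induced path on three vertices. Requiring
  distinct vertices makes the notion independent of the diagonal, so it also fits non-adjacency,
  which is reflexive here.\<close>

definition cluster_on :: "('a \<Rightarrow> 'a \<Rightarrow> bool) \<Rightarrow> 'a set \<Rightarrow> bool" where
  "cluster_on R S \<longleftrightarrow> (\<forall>x\<in>S. \<forall>y\<in>S. \<forall>z\<in>S.
     x \<noteq> y \<longrightarrow> y \<noteq> z \<longrightarrow> x \<noteq> z \<longrightarrow> R x y \<longrightarrow> R y z \<longrightarrow> R x z)"

lemma cluster_onD:
  "cluster_on R S \<Longrightarrow> R x y \<Longrightarrow> R y z \<Longrightarrow> x \<in> S \<Longrightarrow> y \<in> S \<Longrightarrow> z \<in> S \<Longrightarrow>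
     x \<noteq> y \<Longrightarrow> y \<noteq> z \<Longrightarrow> x \<noteq> z \<Longrightarrow> R x z"
  unfolding cluster_on_def by blast

text \<open>Two edges across the cut never form an induced matching in the bipartite graph of the
  cut; equivalently, the neighbourhoods across the cut are nested.\<close>

definition chain_cut :: "('a \<Rightarrow> 'a \<Rightarrow> bool) \<Rightarrow> 'a set \<Rightarrow> 'a set \<Rightarrow> bool" where
  "chain_cut R V A \<longleftrightarrow> (\<forall>a\<in>A. \<forall>b\<in>A. \<forall>c\<in>V - A. \<forall>d\<in>V - A.
     R a c \<longrightarrow> R b d \<longrightarrow> R a d \<or> R b c)"

text \<open>The contrapositive of the condition is the condition for the negated relation with
  \<open>c\<close> and \<open>d\<close> exchanged.\<close>

lemma chain_cut_complement: "chain_cut R V A \<Longrightarrow> chain_cut (\<lambda>x y. \<not> R x y) V A"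
  unfolding chain_cut_def by blast

text \<open>If \<open>S\<close> is a cluster, this is the part inside \<open>A\<close> of the
  cliques that reach beyond \<open>A\<close>: a clique with a vertex outside relates all its inside
  vertices to it.\<close>

definition crossing :: "('a \<Rightarrow> 'a \<Rightarrow> bool) \<Rightarrow> 'a set \<Rightarrow> 'a set \<Rightarrow> 'a set" where
  "crossing R S A = {x \<in> S \<inter> A. \<exists>y \<in> S - A. R x y}"

text \<open>Each of the two vertices has a partner outside. The chain condition relates one of the
  vertices to the partner of the other, and transitivity through this partner gives the
  claim.\<close>

lemma crossing_clique:
  assumes S: "cluster_on R S" "S \<subseteq> V" and R: "symp R" and A: "chain_cut R V A"
    and x: "x \<in> crossing R S A" and x': "x' \<in> crossing R S A" and neq: "x \<noteq> x'"
  shows "R x x'"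
proof -
  from x obtain y where y: "x \<in> S" "x \<in> A" "y \<in> S" "y \<notin> A" "R x y" by (auto simp: crossing_def)
  from x' obtain y' where y': "x' \<in> S" "x' \<in> A" "y' \<in> S" "y' \<notin> A" "R x' y'"
    by (auto simp: crossing_def)
  have "R x y' \<or> R x' y" using A S(2) y y' unfolding chain_cut_def by blast
  then show ?thesis
    using cluster_onD[OF S(1), of x y' x'] cluster_onD[OF S(1), of x y x'] y y' neq sympD[OF R]
    by metis
qed

text \<open>A vertex \<open>x\<close> leaving the union, say from \<open>B\<close>, belongs to the
  crossing clique of \<open>B\<close>. A vertex crossing out of \<open>C\<close> either leaves the
  union itself or is related to a vertex of \<open>B\<close>, which then crosses out of
  \<open>B\<close> and lies in the clique of \<open>x\<close>. If nothing leaves the union, cliques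
  between \<open>B\<close> and \<open>C\<close> may end there; this is the case for
  \<open>close\<close>.\<close>

lemma crossing_Un:
  assumes S: "cluster_on R S" "S \<subseteq> V" and R: "symp R"
    and B: "chain_cut R V B" and C: "chain_cut R V C" and BC: "B \<inter> C = {}"
    and nonempty: "crossing R S (B \<union> C) \<noteq> {}"
  shows "crossing R S (B \<union> C) = crossing R S B \<union> crossing R S C"
proof -
  \<comment> \<open>The claim for \<open>x\<close> in \<open>B\<close>; the case of \<open>x\<close>
    in \<open>C\<close> follows by exchanging \<open>B\<close> and \<open>C\<close>.\<close>
  have main: "crossing R S B \<union> crossing R S C \<subseteq> crossing R S (B \<union> C)"
    if B: "chain_cut R V B" and C: "chain_cut R V C" and BC: "B \<inter> C = {}"
      and x: "x \<in> S" "x \<in> B" "y \<in> S" "y \<notin> B \<union> C" "R x y" for B C x y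
  proof
    have x_cross: "x \<in> crossing R S B" using x by (auto simp: crossing_def)
    have adj: "z \<in> crossing R S (B \<union> C)" if "z \<in> S" "z \<in> B \<union> C" "z = x \<or> R z x" for z
      using that x cluster_onD[OF S(1), of z x y] by (auto simp: crossing_def)
    fix z assume z: "z \<in> crossing R S B \<union> crossing R S C"
    show "z \<in> crossing R S (B \<union> C)"
    proof (cases "z \<in> crossing R S B")
      case True
      then show ?thesis
        using crossing_clique[OF S R B True x_cross] by (intro adj) (auto simp: crossing_def)
    next
      case False
      with z obtain w where w: "z \<in> S" "z \<in> C" "w \<in> S" "w \<notin> C" "R z w"
        by (auto simp: crossing_def)
      show ?thesis
      proof (cases "w \<in> B")
        case False
        with w show ?thesis by (auto simp: crossing_def)
      next
        case True
        then have "w \<in> crossing R S B" using w BC sympD[OF R w(5)] by (auto simp: crossing_def)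
        then have "w = x \<or> R w x" using crossing_clique[OF S R B _ x_cross] by blast
        then have "R z x" using w True x BC cluster_onD[OF S(1), of z w x] by blast
        with w show ?thesis by (intro adj) auto
      qed
    qed
  qed
  from nonempty obtain x y where xy: "x \<in> S" "x \<in> B \<union> C" "y \<in> S" "y \<notin> B \<union> C" "R x y"
    by (auto simp: crossing_def)
  have "crossing R S B \<union> crossing R S C \<subseteq> crossing R S (B \<union> C)"
    using main[OF B C BC xy(1) _ xy(3-5)] main[OF C B _ xy(1) _ xy(3) _ xy(5)] xy BC
    by (auto simp: Un_commute Int_commute)
  then show ?thesis by (auto simp: crossing_def)
qed

text \<open>Let \<open>u\<close> and \<open>w\<close> be partners of \<open>x\<close> and
  \<open>y\<close>. If \<open>u\<close> lies in \<open>C\<close>, it belongs to the crossing clique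
  of \<open>C\<close>, as does \<open>y\<close>; likewise if \<open>w\<close> lies in
  \<open>B\<close>. Otherwise both edges leave the union, whose crossing vertices form one
  clique.\<close>

lemma crossing_complete:
  assumes S: "cluster_on R S" "S \<subseteq> V" and R: "symp R"
    and A: "chain_cut R V (B \<union> C)" and B: "chain_cut R V B" and C: "chain_cut R V C"
    and BC: "B \<inter> C = {}"
    and x: "x \<in> crossing R S B" and y: "y \<in> crossing R S C"
  shows "R x y"
proof -
  have neq: "x \<noteq> y" using x y BC by (auto simp: crossing_def)
  from x obtain u where u: "x \<in> S" "x \<in> B" "u \<in> S" "u \<notin> B" "R x u" by (auto simp: crossing_def)
  from y obtain w where w: "y \<in> S" "y \<in> C" "w \<in> S" "w \<notin> C" "R y w" by (auto simp: crossing_def)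
  consider "u \<in> C" | "w \<in> B" | "u \<notin> B \<union> C" "w \<notin> B \<union> C" using u w by blast
  then show ?thesis
  proof cases
    case 1
    then have "u \<in> crossing R S C" using u BC sympD[OF R u(5)] by (auto simp: crossing_def)
    then have "u = y \<or> R u y" using crossing_clique[OF S R C _ y] by blast
    then show ?thesis using u w neq 1 BC cluster_onD[OF S(1), of x u y] by blast
  next
    case 2
    then have "w \<in> crossing R S B" using w BC sympD[OF R w(5)] by (auto simp: crossing_def)
    then have "w = x \<or> R w x" using crossing_clique[OF S R B _ x] by blast
    then have "R y x" using u w neq 2 BC cluster_onD[OF S(1), of y w x] by blast
    then show ?thesis by (rule sympD[OF R])
  next
    case 3
    then show ?thesis
      using u w neq by (intro crossing_clique[OF S R A]) (auto simp: crossing_def)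
  qed
qed

section \<open>Neighbourhoods across a cut and their representatives\<close>

definition nbr_eq :: "('a \<Rightarrow> 'a \<Rightarrow> bool) \<Rightarrow> 'a set \<Rightarrow> 'a set \<Rightarrow> 'a set \<Rightarrow> bool" where
  "nbr_eq R W X Y \<longleftrightarrow> (\<forall>w\<in>W. (\<forall>x\<in>X. R x w) = (\<forall>x\<in>Y. R x w) \<and> (\<exists>x\<in>X. R x w) = (\<exists>x\<in>Y. R x w))"

lemma nbr_eq_refl: "nbr_eq R W X X"
  by (simp add: nbr_eq_def)

lemma nbr_eq_sym: "nbr_eq R W X Y \<Longrightarrow> nbr_eq R W Y X"
  by (simp add: nbr_eq_def)

lemma nbr_eq_trans: "nbr_eq R W X Y \<Longrightarrow> nbr_eq R W Y Z \<Longrightarrow> nbr_eq R W X Z"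
  by (simp add: nbr_eq_def)

lemma nbr_eq_mono: "nbr_eq R W X Y \<Longrightarrow> W' \<subseteq> W \<Longrightarrow> nbr_eq R W' X Y"
  by (auto simp: nbr_eq_def)

lemma nbr_eq_Un: "nbr_eq R W X X' \<Longrightarrow> nbr_eq R W Y Y' \<Longrightarrow> nbr_eq R W (X \<union> Y) (X' \<union> Y')"
  unfolding nbr_eq_def ball_Un bex_Un by simp

text \<open>The exchange step. Complete or empty adjacency survives replacing \<open>X'\<close> by
  \<open>X\<close>, seen from \<open>Y'\<close>, and then \<open>Y'\<close> by \<open>Y\<close>,
  seen from \<open>X\<close>; common neighbourhoods handle the complete case and unions the empty
  one.\<close>

lemma nbr_eq_transfer:
  assumes X: "nbr_eq R W X X'" and Y: "nbr_eq R W' Y Y'" and "Y' \<subseteq> W" "X \<subseteq> W'" and R: "symp R"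
    and all: "\<And>x y. x \<in> X' \<Longrightarrow> y \<in> Y' \<Longrightarrow> R x y = b" and "x \<in> X" "y \<in> Y"
  shows "R x y = b"
proof -
  have XY': "R x' y' = b" if "x' \<in> X" "y' \<in> Y'" for x' y'
  proof (cases b)
    case True
    then have "\<forall>x\<in>X'. R x y'" using all that by blast
    then show ?thesis using X that assms(3) True unfolding nbr_eq_def by blast
  next
    case False
    then have "\<not> (\<exists>x\<in>X'. R x y')" using all that by blast
    then show ?thesis using X that assms(3) False unfolding nbr_eq_def by blast
  qed
  have flip: "R u v = R v u" for u v using sympD[OF R] by blast
  show ?thesis
  proof (cases b)
    case True
    then have "\<forall>y\<in>Y'. R y x" using XY' assms(7) flip by blast
    then have "\<forall>y\<in>Y. R y x" using Y assms(4,7) unfolding nbr_eq_def by blast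
    then show ?thesis using True assms(8) flip by blast
  next
    case False
    then have "\<not> (\<exists>y\<in>Y'. R y x)" using XY' assms(7) flip by blast
    then have "\<not> (\<exists>y\<in>Y. R y x)" using Y assms(4,7) unfolding nbr_eq_def by blast
    then show ?thesis using False assms(8) flip by blast
  qed
qed

lemma chain_cut_least:
  assumes "chain_cut R V A" "finite X" "X \<noteq> {}" "X \<subseteq> A"
  shows "\<exists>a\<in>X. \<forall>x\<in>X. \<forall>w\<in>V - A. R a w \<longrightarrow> R x w"
  using assms(2-4)
proof (induction X rule: finite_ne_induct)
  case (insert y X)
  then obtain a where a: "a \<in> X" "\<forall>x\<in>X. \<forall>w\<in>V - A. R a w \<longrightarrow> R x w" by auto
  show ?case
  proof (cases "\<forall>w\<in>V - A. R a w \<longrightarrow> R y w")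
    case True
    with a show ?thesis by auto
  next
    case False
    then obtain w where "w \<in> V - A" "R a w" "\<not> R y w" by blast
    then have "\<forall>w\<in>V - A. R y w \<longrightarrow> R a w"
      using assms(1) a(1) insert.prems unfolding chain_cut_def by blast
    with a show ?thesis by (intro bexI[of _ y]) auto
  qed
qed auto

text \<open>\<open>a\<close> has the least neighbourhood across the cut, which is the common one of
  \<open>X\<close>. Applying the same lemma to the complement gives \<open>b\<close> with the
  greatest, which is the union.\<close>

lemma chain_cut_representatives:
  assumes A: "chain_cut R V A" and X: "finite X" "X \<noteq> {}" "X \<subseteq> A"
  obtains a b where "a \<in> X" "b \<in> X" "nbr_eq R (V - A) X {a, b}"
proof -
  from chain_cut_least[OF A X] obtain a where a: "a \<in> X" "\<forall>x\<in>X. \<forall>w\<in>V - A. R a w \<longrightarrow> R x w"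
    by blast
  from chain_cut_least[OF chain_cut_complement[OF A] X] obtain b where
    b: "b \<in> X" "\<forall>x\<in>X. \<forall>w\<in>V - A. \<not> R b w \<longrightarrow> \<not> R x w"
    by blast
  have "nbr_eq R (V - A) X {a, b}"
    unfolding nbr_eq_def using a b by blast
  with a b that show thesis by blast
qed

section \<open>Correctness of the dynamic program\<close>

text \<open>\<open>True\<close> selects adjacency for the cluster half, \<open>False\<close>
  non-adjacency for the co-cluster half.\<close>

abbreviation adj_is :: "bool list list \<Rightarrow> bool \<Rightarrow> nat \<Rightarrow> nat \<Rightarrow> bool" where
  "adj_is M b x y \<equiv> adj M x y = b"

lemma symp_adj_is: "symp (adj M) \<Longrightarrow> symp (adj_is M b)"
  unfolding symp_def by blast

lemma chain_cut_adj_is: "chain_cut (adj M) V A \<Longrightarrow> chain_cut (adj_is M b) V A"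
  using chain_cut_complement[of "adj M" V A] by (cases b) simp_all

definition half_ok :: "bool list list \<Rightarrow> bool \<Rightarrow> half \<Rightarrow> bool" where
  "half_ok M b h \<longleftrightarrow> cluster_on (adj_is M b) (set (fst h)) \<and>
     (\<forall>x\<in>set (snd h). \<forall>y\<in>set (snd h). x \<noteq> y \<longrightarrow> adj_is M b x y) \<and>
     (\<forall>x\<in>set (fst h). \<forall>y\<in>set (snd h). \<not> adj_is M b x y)"

lemma half_ok_cluster:
  assumes "half_ok M b h" "symp (adj M)"
  shows "cluster_on (adj_is M b) (set (fst h) \<union> set (snd h))"
  using assms(1) sympD[OF symp_adj_is[OF assms(2), of b]]
  unfolding half_ok_def cluster_on_def by (simp only: ball_Un) blast

lemma half_ok_close:
  assumes "half_ok M b h" "symp (adj M)"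
  shows "half_ok M b (close h)"
  using half_ok_cluster[OF assms] by (simp add: half_ok_def close_def)

lemma cluster_on_disjoint_Un:
  assumes "cluster_on R X" "cluster_on R Y" "symp R" "\<And>x y. x \<in> X \<Longrightarrow> y \<in> Y \<Longrightarrow> \<not> R x y"
  shows "cluster_on R (X \<union> Y)"
  using assms(1,2,4) sympD[OF assms(3)] unfolding cluster_on_def by (simp only: ball_Un) blast

lemma half_ok_merge:
  assumes h: "half_ok M b h" and h': "half_ok M b h'" and M: "symp (adj M)" and c: "compat M b h h'"
  shows "half_ok M b (merge h h')"
proof -
  note s = sympD[OF symp_adj_is[OF M, of b]]
  have c1: "adj_is M b x y" if "x \<in> set (snd h)" "y \<in> set (snd h')" for x y
    using c that by (simp add: compat_def list_all_iff)
  have c2: "\<not> adj_is M b x y" if "x \<in> set (snd h)" "y \<in> set (fst h')" for x y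
    using c that by (simp add: compat_def list_all_iff)
  have c3: "\<not> adj_is M b x y" if "x \<in> set (fst h)" "y \<in> set (fst h') \<union> set (snd h')" for x y
    using c that by (simp add: compat_def list_all_iff)
  have "cluster_on (adj_is M b) (set (fst h) \<union> set (fst h'))"
    using h h' c3 by (intro cluster_on_disjoint_Un symp_adj_is M) (auto simp: half_ok_def)
  moreover have "adj_is M b x y"
    if "x \<in> set (snd h) \<union> set (snd h')" "y \<in> set (snd h) \<union> set (snd h')" "x \<noteq> y" for x y
    using that h h' c1[of x y] s[OF c1[of y x]] unfolding half_ok_def by (elim UnE) simp_all
  moreover have "\<not> adj_is M b x y"
    if "x \<in> set (fst h) \<union> set (fst h')" "y \<in> set (snd h) \<union> set (snd h')" for x y
    using that h h' c3[of x y] c2[of y x] s[of x y] unfolding half_ok_def by (elim UnE) auto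
  ultimately show ?thesis
    unfolding half_ok_def merge_def fst_conv snd_conv set_append by blast
qed

definition partial_solution :: "bool list list \<Rightarrow> nat set \<Rightarrow> half \<times> half \<Rightarrow> bool" where
  "partial_solution M A p \<longleftrightarrow> distinct (covered p) \<and> set (covered p) \<subseteq> A \<and>
     half_ok M True (fst p) \<and> half_ok M False (snd p)"

lemma mset_covered_joins:
  assumes "r \<in> set (joins M p q)"
  shows "mset (covered r) = mset (covered p @ covered q)"
  using assms by (auto simp: joins_def covered_def merge_def close_def ac_simps split: if_splits)

lemma partial_solution_joins:
  assumes M: "symp (adj M)" and p: "partial_solution M A p" and q: "partial_solution M B q"
    and AB: "A \<inter> B = {}" and r: "r \<in> set (joins M p q)"
  shows "partial_solution M (A \<union> B) r"
proof -
  have compat: "compat M True (fst p) (fst q)" "compat M False (snd p) (snd q)"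
    using r by (auto simp: joins_def split: if_splits)
  have halves: "fst r = merge (fst p) (fst q) \<or> fst r = close (merge (fst p) (fst q))"
    "snd r = merge (snd p) (snd q) \<or> snd r = close (merge (snd p) (snd q))"
    using r by (auto simp: joins_def split: if_splits)
  have "half_ok M True (fst r)" "half_ok M False (snd r)"
    using halves half_ok_merge[OF _ _ M compat(1)] half_ok_merge[OF _ _ M compat(2)]
      half_ok_close[OF _ M] p q unfolding partial_solution_def by metis+
  moreover note mset_eq_setD[OF mset_covered_joins[OF r]]
    mset_eq_imp_distinct_iff[OF mset_covered_joins[OF r]]
  ultimately show ?thesis
    using p q AB unfolding partial_solution_def by auto
qed

lemma partial_solution_candidates:
  assumes M: "symp (adj M)"
  shows "distinct (leaf_list t) \<Longrightarrow> p \<in> set (candidates (M, V) t) \<Longrightarrow>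
    partial_solution M (set (leaf_list t)) p"
proof (induction t arbitrary: p)
  case (Leaf v)
  then show ?case
    by (auto simp: leaf_candidates_def partial_solution_def covered_def half_ok_def cluster_on_def)
next
  case (Fork l r)
  have "p \<in> set (all_joins M (candidates (M, V) l) (candidates (M, V) r))"
    using Fork.prems(2) set_prune_subset by (simp, blast)
  then obtain q q' where
    "q \<in> set (candidates (M, V) l)" "q' \<in> set (candidates (M, V) r)" "p \<in> set (joins M q q')"
    unfolding in_all_joins by blast
  with partial_solution_joins[OF M Fork.IH(1) Fork.IH(2)] Fork.prems(1) show ?case
    by simp
qed

text \<open>The invariant of the exchange argument: \<open>h\<close> imitates the part of
  \<open>S\<close> inside \<open>A\<close> as seen from outside, without having to be contained in
  \<open>S\<close>.\<close>

definition represents ::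
  "bool list list \<Rightarrow> nat set \<Rightarrow> bool \<Rightarrow> nat set \<Rightarrow> nat set \<Rightarrow> half \<Rightarrow> bool" where
  "represents M V b S A h \<longleftrightarrow>
     nbr_eq (adj M) (V - A) (set (snd h)) (crossing (adj_is M b) S A) \<and>
     nbr_eq (adj M) (V - A) (set (fst h)) (S \<inter> A - crossing (adj_is M b) S A)"

text \<open>The required adjacencies hold between the parts of \<open>S\<close> itself: the crossing
  parts are completely related by \<open>crossing_complete\<close>, and a vertex of
  \<open>?O X\<close> has no related vertex in \<open>S\<close> beyond \<open>X\<close>.
  \<open>nbr_eq_transfer\<close> carries them over to \<open>h\<close> and
  \<open>h'\<close>.\<close>

lemma compat_represents:
  assumes M: "symp (adj M)" and S: "cluster_on (adj_is M b) S" "S \<subseteq> V"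
    and cuts: "chain_cut (adj M) V (A \<union> B)" "chain_cut (adj M) V A" "chain_cut (adj M) V B"
    and V: "A \<subseteq> V" "B \<subseteq> V" and AB: "A \<inter> B = {}"
    and h: "represents M V b S A h" "set (fst h) \<union> set (snd h) \<subseteq> A"
    and h': "represents M V b S B h'" "set (fst h') \<union> set (snd h') \<subseteq> B"
  shows "compat M b h h'"
proof -
  let ?R = "adj_is M b"
  note cuts = cuts[THEN chain_cut_adj_is, of b]
  note s = symp_adj_is[OF M, of b]
  let ?O = "\<lambda>X. S \<inter> X - crossing ?R S X"
  have isolated: "?R x y = False" if "x \<in> ?O X" "y \<in> S - X" for x y X
    using that by (auto simp: crossing_def)
  have sides: "crossing ?R S A \<subseteq> S - B" "?O A \<subseteq> S - B" "crossing ?R S B \<subseteq> S - A" "?O B \<subseteq> S - A"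
    using AB by (auto simp: crossing_def)
  then have subV: "crossing ?R S B \<subseteq> V - A" "?O B \<subseteq> V - A" using S(2) by auto
  have sub: "set (snd h) \<subseteq> V - B" "set (fst h) \<subseteq> V - B" using h(2) V AB by auto
  have eq: "nbr_eq (adj M) (V - A) (set (snd h)) (crossing ?R S A)"
    "nbr_eq (adj M) (V - A) (set (fst h)) (?O A)"
    "nbr_eq (adj M) (V - B) (set (snd h')) (crossing ?R S B)"
    "nbr_eq (adj M) (V - B) (set (fst h')) (?O B)"
    using h(1) h'(1) by (simp_all add: represents_def)
  have "adj M x y = b" if "x \<in> set (snd h)" "y \<in> set (snd h')" for x y
    using crossing_complete[OF S s cuts AB] that
    by (rule nbr_eq_transfer[OF eq(1) eq(3) subV(1) sub(1) M])
  moreover have "adj M x y = (\<not> b)" if "x \<in> set (snd h)" "y \<in> set (fst h')" for x y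
  proof (rule nbr_eq_transfer[OF eq(1) eq(4) subV(2) sub(1) M _ that])
    fix x y assume xy: "x \<in> crossing ?R S A" "y \<in> ?O B"
    then have "\<not> ?R y x" using isolated[OF xy(2), of x] sides(1) by blast
    then show "adj M x y = (\<not> b)" using sympD[OF s, of x y] by blast
  qed
  moreover have "adj M x y = (\<not> b)" if "x \<in> set (fst h)" "y \<in> set (snd h')" for x y
  proof (rule nbr_eq_transfer[OF eq(2) eq(3) subV(1) sub(2) M _ that])
    fix x y assume xy: "x \<in> ?O A" "y \<in> crossing ?R S B"
    then show "adj M x y = (\<not> b)" using isolated[OF xy(1), of y] sides(3) by blast
  qed
  moreover have "adj M x y = (\<not> b)" if "x \<in> set (fst h)" "y \<in> set (fst h')" for x y
  proof (rule nbr_eq_transfer[OF eq(2) eq(4) subV(2) sub(2) M _ that])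
    fix x y assume xy: "x \<in> ?O A" "y \<in> ?O B"
    then show "adj M x y = (\<not> b)" using isolated[OF xy(1), of y] sides(4) by blast
  qed
  ultimately show ?thesis
    by (auto simp: compat_def list_all_iff)
qed

text \<open>If no clique of \<open>S\<close> leaves the union, all four parts are finished and the
  closed version fits. Otherwise \<open>crossing_Un\<close> splits the crossing part, and the merge
  fits list by list.\<close>

lemma represents_merge:
  assumes M: "symp (adj M)" and S: "cluster_on (adj_is M b) S" "S \<subseteq> V"
    and cuts: "chain_cut (adj M) V A" "chain_cut (adj M) V B"
    and AB: "A \<inter> B = {}"
    and h: "represents M V b S A h" and h': "represents M V b S B h'"
  shows "represents M V b S (A \<union> B) (merge h h') \<or> represents M V b S (A \<union> B) (close (merge h h'))"
proof -
  let ?R = "adj_is M b"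
  let ?W = "V - (A \<union> B)"
  have eq: "nbr_eq (adj M) ?W (set (snd h)) (crossing ?R S A)"
    "nbr_eq (adj M) ?W (set (fst h)) (S \<inter> A - crossing ?R S A)"
    "nbr_eq (adj M) ?W (set (snd h')) (crossing ?R S B)"
    "nbr_eq (adj M) ?W (set (fst h')) (S \<inter> B - crossing ?R S B)"
    using h h' unfolding represents_def by (auto elim!: nbr_eq_mono)
  have parts: "crossing ?R S X \<subseteq> S \<inter> X" for X by (auto simp: crossing_def)
  show ?thesis
  proof (cases "crossing ?R S (A \<union> B) = {}")
    case True
    have "S \<inter> (A \<union> B) = ((S \<inter> A - crossing ?R S A) \<union> (S \<inter> B - crossing ?R S B)) \<union>
        (crossing ?R S A \<union> crossing ?R S B)"
      using parts[of A] parts[of B] by blast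
    then have "represents M V b S (A \<union> B) (close (merge h h'))"
      unfolding represents_def close_def merge_def True fst_conv snd_conv set_append
      using nbr_eq_Un[OF nbr_eq_Un[OF eq(2,4)] nbr_eq_Un[OF eq(1,3)]]
      by (simp add: nbr_eq_refl)
    then show ?thesis ..
  next
    case False
    have cross: "crossing ?R S (A \<union> B) = crossing ?R S A \<union> crossing ?R S B"
      by (rule crossing_Un[OF S symp_adj_is[OF M] cuts[THEN chain_cut_adj_is] AB False])
    have "S \<inter> (A \<union> B) - (crossing ?R S A \<union> crossing ?R S B) =
        (S \<inter> A - crossing ?R S A) \<union> (S \<inter> B - crossing ?R S B)"
      using parts[of A] parts[of B] AB by blast
    then have "represents M V b S (A \<union> B) (merge h h')"
      unfolding represents_def merge_def cross fst_conv snd_conv set_append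
      using nbr_eq_Un[OF eq(2,4)] nbr_eq_Un[OF eq(1,3)] by simp
    then show ?thesis ..
  qed
qed

lemma same_neighbours_iff: "same_neighbours M W X Y \<longleftrightarrow> nbr_eq (adj M) (set W) (set X) (set Y)"
  by (simp add: same_neighbours_def nbr_eq_def list_all_iff list_ex_iff)

lemma set_outside: "set (outside V L) = set V - set L"
  by (auto simp: outside_def list_ex_iff)

lemma in_all_pairs: "(a, b) \<in> set (all_pairs xs) \<longleftrightarrow> a \<in> set xs \<and> b \<in> set xs"
  by (auto simp: all_pairs_def)

lemma similar_key:
  assumes cut: "chain_cut (adj M) (set V) (set L)" and p: "set (covered p) \<subseteq> set L"
  shows "\<exists>k \<in> set (keys L). similar M (outside V L) k p"
proof -
  have "\<exists>Y \<in> set ([] # map (\<lambda>z. [fst z, snd z]) (all_pairs L)). same_neighbours M (outside V L) Y X"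
    if X: "set X \<subseteq> set L" for X
  \<comment> \<open>The empty set has every vertex as a common neighbour and none in the union, so
    it gets the key \<open>[]\<close>; pairs \<open>[a, b]\<close>, possibly with
    \<open>a = b\<close>, serve nonempty sets.\<close>
  proof (cases "X = []")
    case True
    then show ?thesis by (simp add: same_neighbours_iff nbr_eq_refl)
  next
    case False
    with chain_cut_representatives[OF cut, of "set X"] X obtain a b where
      ab: "a \<in> set X" "b \<in> set X" "nbr_eq (adj M) (set V - set L) (set X) {a, b}"
      by auto
    then have "same_neighbours M (outside V L) [a, b] X"
      by (simp add: same_neighbours_iff set_outside nbr_eq_sym)
    moreover have "[a, b] \<in> set ([] # map (\<lambda>z. [fst z, snd z]) (all_pairs L))"
      using ab X in_all_pairs[of a b L] by force
    ultimately show ?thesis by blast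
  qed
  note ex = this
  have sub: "set (fst (fst p)) \<subseteq> set L" "set (snd (fst p)) \<subseteq> set L"
    "set (fst (snd p)) \<subseteq> set L" "set (snd (snd p)) \<subseteq> set L"
    using p by (auto simp: covered_def)
  from ex[OF sub(1)] obtain Y1 where Y1:
    "Y1 \<in> set ([] # map (\<lambda>z. [fst z, snd z]) (all_pairs L))"
    "same_neighbours M (outside V L) Y1 (fst (fst p))"
    by (rule bexE)
  from ex[OF sub(2)] obtain Y2 where Y2:
    "Y2 \<in> set ([] # map (\<lambda>z. [fst z, snd z]) (all_pairs L))"
    "same_neighbours M (outside V L) Y2 (snd (fst p))"
    by (rule bexE)
  from ex[OF sub(3)] obtain Y3 where Y3:
    "Y3 \<in> set ([] # map (\<lambda>z. [fst z, snd z]) (all_pairs L))"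
    "same_neighbours M (outside V L) Y3 (fst (snd p))"
    by (rule bexE)
  from ex[OF sub(4)] obtain Y4 where Y4:
    "Y4 \<in> set ([] # map (\<lambda>z. [fst z, snd z]) (all_pairs L))"
    "same_neighbours M (outside V L) Y4 (snd (snd p))"
    by (rule bexE)
  show ?thesis
    by (rule bexI[of _ "((Y1, Y2), (Y3, Y4))"])
      (use Y1 Y2 Y3 Y4 in \<open>simp_all only: keys_def in_all_pairs similar_def fst_conv snd_conv simp_thms\<close>)
qed

lemma largest_member:
  assumes "p \<in> set P"
  shows "\<exists>q \<in> set (largest P). length (covered p) \<le> length (covered q)"
proof -
  let ?F = "filter (\<lambda>p. list_all (\<lambda>q. length (covered q) \<le> length (covered p)) P) P"
  have "Max ((\<lambda>p. length (covered p)) ` set P) \<in> (\<lambda>p. length (covered p)) ` set P"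
    using assms by (intro Max_in) auto
  then obtain m where m: "m \<in> set P"
    "Max ((\<lambda>p. length (covered p)) ` set P) = length (covered m)"
    by (rule imageE)
  have "length (covered q) \<le> length (covered m)" if "q \<in> set P" for q
    unfolding m(2)[symmetric] using that by (intro Max_ge) auto
  with m(1) have "m \<in> set ?F" by (simp add: list_all_iff)
  then obtain q qs where F: "?F = q # qs" by (cases ?F) auto
  then have "q \<in> set ?F" by simp
  then have "length (covered p) \<le> length (covered q)" using assms by (simp add: list_all_iff)
  moreover have "q \<in> set (largest P)" unfolding largest_def F by simp
  ultimately show ?thesis by blast
qed

text \<open>Some key \<open>k\<close> is similar to \<open>p\<close>; the entry chosen for
  \<open>k\<close> is also similar to \<open>k\<close>, hence to \<open>p\<close>, and was chosen as
  a largest one from a list containing \<open>p\<close>.\<close>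

lemma prune_member:
  assumes "chain_cut (adj M) (set V) (set L)" "set (covered p) \<subseteq> set L" "p \<in> set P"
  shows "\<exists>q \<in> set (prune M (outside V L) (keys L) P).
    similar M (outside V L) q p \<and> length (covered p) \<le> length (covered q)"
proof -
  from similar_key[OF assms(1,2)] obtain k where
    k: "k \<in> set (keys L)" "similar M (outside V L) k p" by blast
  with assms(3) have "p \<in> set (filter (similar M (outside V L) k) P)" by simp
  from largest_member[OF this] obtain q where
    q: "q \<in> set (largest (filter (similar M (outside V L) k) P))"
    "length (covered p) \<le> length (covered q)" by blast
  then have "similar M (outside V L) k q" using set_largest_subset by fastforce
  with k(2) have "similar M (outside V L) q p"
    unfolding similar_def same_neighbours_iff nbr_eq_def by (elim conjE, intro conjI) simp_all
  moreover have "q \<in> set (prune M (outside V L) (keys L) P)"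
    using k(1) q(1) by (auto simp: prune_def)
  ultimately show ?thesis using q(2) by blast
qed

lemma represents_cong:
  assumes "represents M V b S A h" "nbr_eq (adj M) (V - A) (set (fst h')) (set (fst h))"
    "nbr_eq (adj M) (V - A) (set (snd h')) (set (snd h))"
  shows "represents M V b S A h'"
  using assms unfolding represents_def by (metis nbr_eq_trans)

text \<open>Unlike \<^const>\<open>edge_cuts\<close>, this includes the set of all leaves, at the root of the tree.\<close>

fun subtree_cuts :: "'a layout \<Rightarrow> 'a set set" where
  "subtree_cuts (Leaf v) = {{v}}"
| "subtree_cuts (Fork l r) =
     {set (leaf_list l) \<union> set (leaf_list r)} \<union> subtree_cuts l \<union> subtree_cuts r"

lemma leaf_set_in_subtree_cuts: "set (leaf_list t) \<in> subtree_cuts t"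
  by (cases t) auto

text \<open>The exchange argument as an induction over the tree: some candidate imitates the given
  solution towards the outside and covers at least as many vertices. At a fork, the candidates of
  the children are compatible, one of the four joins imitates the solution, and pruning replaces it
  by a similar one that is no smaller.\<close>

lemma candidates_complete:
  assumes M: "symp (adj M)"
    and S1: "cluster_on (adj_is M True) S1" "S1 \<subseteq> set V"
    and S2: "cluster_on (adj_is M False) S2" "S2 \<subseteq> set V"
    and disj: "S1 \<inter> S2 = {}"
  shows "distinct (leaf_list t) \<Longrightarrow> set (leaf_list t) \<subseteq> set V \<Longrightarrow>
    \<forall>A \<in> subtree_cuts t. chain_cut (adj M) (set V) A \<Longrightarrow>
    \<exists>p \<in> set (candidates (M, V) t).
      represents M (set V) True S1 (set (leaf_list t)) (fst p) \<and>
      represents M (set V) False S2 (set (leaf_list t)) (snd p) \<and>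
      card ((S1 \<union> S2) \<inter> set (leaf_list t)) \<le> length (covered p)"
proof (induction t)
  case (Leaf v)
  \<comment> \<open>The last conjunct matters for pairing: as \<open>S1\<close> and
    \<open>S2\<close> are disjoint, one of the two halves is empty, so the pair is among the leaf
    candidates.\<close>
  have half: "\<exists>h \<in> {([], []), ([v], []), ([], [v])}. represents M (set V) b S {v} h \<and>
      length (fst h @ snd h) = card (S \<inter> {v}) \<and> (v \<notin> S \<longrightarrow> h = ([], []))" for b S
  proof (cases "v \<in> S")
    case False
    then have "S \<inter> {v} = {}" "crossing (adj_is M b) S {v} = {}" by (auto simp: crossing_def)
    with False show ?thesis by (auto simp: represents_def nbr_eq_refl)
  next
    case True
    then have S: "S \<inter> {v} = {v}" by auto
    then have "crossing (adj_is M b) S {v} = {} \<or> crossing (adj_is M b) S {v} = {v}"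
      by (auto simp: crossing_def)
    with True S show ?thesis by (auto simp: represents_def nbr_eq_refl)
  qed
  from half[of True S1] obtain h where h: "h \<in> {([], []), ([v], []), ([], [v])}"
    "represents M (set V) True S1 {v} h" "length (fst h @ snd h) = card (S1 \<inter> {v})"
    "v \<notin> S1 \<longrightarrow> h = ([], [])" by blast
  from half[of False S2] obtain h' where h': "h' \<in> {([], []), ([v], []), ([], [v])}"
    "represents M (set V) False S2 {v} h'" "length (fst h' @ snd h') = card (S2 \<inter> {v})"
    "v \<notin> S2 \<longrightarrow> h' = ([], [])" by blast
  have "(h, h') \<in> set (candidates (M, V) (Leaf v))"
    using h(1,4) h'(1,4) disj by (auto simp: leaf_candidates_def)
  moreover have "card ((S1 \<union> S2) \<inter> {v}) \<le> card (S1 \<inter> {v}) + card (S2 \<inter> {v})"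
    by (simp add: Int_Un_distrib2 card_Un_le)
  then have "card ((S1 \<union> S2) \<inter> {v}) \<le> length (covered (h, h'))"
    using h(3) h'(3) by (simp add: covered_def)
  ultimately show ?case using h(2) h'(2) by (intro bexI[of _ "(h, h')"]) auto
next
  case (Fork l r)
  let ?A = "set (leaf_list l)" and ?B = "set (leaf_list r)"
  have AB: "?A \<inter> ?B = {}" and V: "?A \<subseteq> set V" "?B \<subseteq> set V"
    using Fork.prems(1,2) by auto
  have cuts: "chain_cut (adj M) (set V) (?A \<union> ?B)" "chain_cut (adj M) (set V) ?A"
    "chain_cut (adj M) (set V) ?B"
    using Fork.prems(3) leaf_set_in_subtree_cuts[of l] leaf_set_in_subtree_cuts[of r] by simp_all
  have dist: "distinct (leaf_list l)" "distinct (leaf_list r)" using Fork.prems(1) by simp_all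
  have sub_cuts: "\<forall>A \<in> subtree_cuts l. chain_cut (adj M) (set V) A"
    "\<forall>A \<in> subtree_cuts r. chain_cut (adj M) (set V) A"
    using Fork.prems(3) by simp_all
  from Fork.IH(1)[OF dist(1) V(1) sub_cuts(1)] obtain p where p: "p \<in> set (candidates (M, V) l)"
    "represents M (set V) True S1 ?A (fst p)" "represents M (set V) False S2 ?A (snd p)"
    "card ((S1 \<union> S2) \<inter> ?A) \<le> length (covered p)"
    by blast
  from Fork.IH(2)[OF dist(2) V(2) sub_cuts(2)] obtain q where q: "q \<in> set (candidates (M, V) r)"
    "represents M (set V) True S1 ?B (fst q)" "represents M (set V) False S2 ?B (snd q)"
    "card ((S1 \<union> S2) \<inter> ?B) \<le> length (covered q)"
    by blast
  have pq: "partial_solution M ?A p" "partial_solution M ?B q"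
    using partial_solution_candidates[OF M] p(1) q(1) dist by simp_all
  have "compat M True (fst p) (fst q)"
    using pq by (intro compat_represents[OF M S1 cuts V AB p(2) _ q(2)])
      (auto simp: partial_solution_def covered_def)
  moreover have "compat M False (snd p) (snd q)"
    using pq by (intro compat_represents[OF M S2 cuts V AB p(3) _ q(3)])
      (auto simp: partial_solution_def covered_def)
  ultimately have joins: "joins M p q = [(merge (fst p) (fst q), merge (snd p) (snd q)),
      (close (merge (fst p) (fst q)), merge (snd p) (snd q)),
      (merge (fst p) (fst q), close (merge (snd p) (snd q))),
      (close (merge (fst p) (fst q)), close (merge (snd p) (snd q)))]"
    by (simp add: joins_def)
  have "\<exists>h \<in> {merge (fst p) (fst q), close (merge (fst p) (fst q))}.
      represents M (set V) True S1 (?A \<union> ?B) h"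
    using represents_merge[OF M S1 cuts(2,3) AB p(2) q(2)] by simp
  then obtain h where h: "h \<in> {merge (fst p) (fst q), close (merge (fst p) (fst q))}"
      "represents M (set V) True S1 (?A \<union> ?B) h" by (rule bexE)
  have "\<exists>h \<in> {merge (snd p) (snd q), close (merge (snd p) (snd q))}.
      represents M (set V) False S2 (?A \<union> ?B) h"
    using represents_merge[OF M S2 cuts(2,3) AB p(3) q(3)] by simp
  then obtain h' where h': "h' \<in> {merge (snd p) (snd q), close (merge (snd p) (snd q))}"
      "represents M (set V) False S2 (?A \<union> ?B) h'" by (rule bexE)
  define j where "j = (h, h')"
  have j: "j \<in> set (joins M p q)" "represents M (set V) True S1 (?A \<union> ?B) (fst j)"
    "represents M (set V) False S2 (?A \<union> ?B) (snd j)"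
    using h h' unfolding joins j_def by auto
  let ?L = "leaf_list l @ leaf_list r"
  have sub: "set (covered j) \<subseteq> set ?L"
    using partial_solution_joins[OF M pq AB j(1)] by (simp add: partial_solution_def)
  have mem: "j \<in> set (all_joins M (candidates (M, V) l) (candidates (M, V) r))"
    using p(1) q(1) j(1) unfolding in_all_joins by blast
  have cut: "chain_cut (adj M) (set V) (set ?L)" using cuts(1) by simp
  from prune_member[OF cut sub mem] obtain k where k: "k \<in> set (prune M (outside V ?L) (keys ?L)
      (all_joins M (candidates (M, V) l) (candidates (M, V) r)))"
    "similar M (outside V ?L) k j" "length (covered j) \<le> length (covered k)"
    by blast
  have W: "set (outside V ?L) = set V - (?A \<union> ?B)" by (simp add: set_outside)
  note k_eq = k(2)[unfolded similar_def same_neighbours_iff W]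
  have "represents M (set V) True S1 (?A \<union> ?B) (fst k)"
    by (rule represents_cong[OF j(2)]) (use k_eq in blast)+
  moreover have "represents M (set V) False S2 (?A \<union> ?B) (snd k)"
    by (rule represents_cong[OF j(3)]) (use k_eq in blast)+
  moreover have "card ((S1 \<union> S2) \<inter> (?A \<union> ?B)) \<le> length (covered k)"
    using card_Un_le[of "(S1 \<union> S2) \<inter> ?A" "(S1 \<union> S2) \<inter> ?B"] p(4) q(4) k(3)
      mset_eq_length[OF mset_covered_joins[OF j(1)]] by (simp add: Int_Un_distrib)
  ultimately show ?case using k(1)
    by (intro bexI[of _ k]) (simp_all only: candidates.simps leaf_list.simps set_append fst_conv snd_conv simp_thms)
qed

section \<open>Cluster graphs, polar graphs and mim-width\<close>

lemma (in graph) graph_induce: "S \<subseteq> verts G \<Longrightarrow> graph (G \<restriction> S)"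
  by (intro graph.intro pseudo_graph.intro digraphI_induced induced_graph_imp_graph induced_induce
      fin_digraph.intro digraph.axioms(1)[OF digraphI_induced])

text \<open>Forwards, the vertices reachable from \<open>x\<close> induce a component, which is
  complete. Backwards, the condition shortens walks, so that distinct vertices connected by a walk
  are adjacent.\<close>

lemma (in graph) cluster_graph_iff:
  "cluster_graph G \<longleftrightarrow> cluster_on (\<lambda>x y. (x, y) \<in> arcs_ends G) (verts G)"
proof
  assume cluster: "cluster_graph G"
  show "cluster_on (\<lambda>x y. (x, y) \<in> arcs_ends G) (verts G)"
    unfolding cluster_on_def
  proof (intro ballI impI)
    fix x y z assume xyz: "x \<in> verts G" "y \<in> verts G" "z \<in> verts G" "x \<noteq> z"
      "(x, y) \<in> arcs_ends G" "(y, z) \<in> arcs_ends G"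
    let ?C = "G \<restriction> {v. x \<rightarrow>\<^sup>* v}"
    have "complete_digraph (card (verts ?C)) ?C"
      using cluster induce_reachable_is_in_sccs[OF xyz(1)] unfolding cluster_graph_def by blast
    moreover have "x \<rightarrow>\<^sup>* z" using xyz(5,6) by (meson adj_reachable_trans reachable_adjI)
    ultimately have "(x, z) \<in> arcs_ends ?C"
      using xyz(1,4) by (simp add: complete_digraph_def)
    then show "(x, z) \<in> arcs_ends G" by (rule dominates_induce_subgraphD)
  qed
next
  assume cluster: "cluster_on (\<lambda>x y. (x, y) \<in> arcs_ends G) (verts G)"
  have adj: "u = v \<or> (u, v) \<in> arcs_ends G" if "u \<rightarrow>\<^sup>* v" for u v
    using that
  proof (induction rule: reachable_induct)
    case (step v w)
    then show ?case
      using cluster_onD[OF cluster, of u v w] adj_in_verts reachable_in_verts by metis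
  qed simp
  have "complete_digraph (card (verts C)) C" if C: "C \<in> sccs" for C
  proof -
    have ind: "induced_subgraph C G" and conn: "strongly_connected C"
      using C by (auto simp: sccs_def)
    interpret C: graph C
      by (rule graph.intro[OF digraphI_induced[OF ind] pseudo_graph.intro])
        (use digraphI_induced[OF ind] induced_graph_imp_graph[OF ind] in \<open>auto simp: digraph_def\<close>)
    have ends: "tail C = tail G" "head C = head G"
      using ind by (auto simp: induced_subgraph_def subgraph_def compatible_def)
    have arcs: "arcs C = {e \<in> arcs G. tail G e \<in> verts C \<and> head G e \<in> verts C}"
      using ind by (auto simp: induced_subgraph_def)
    have "(u, v) \<in> arcs_ends C" if "u \<in> verts C" "v \<in> verts C" "u \<noteq> v" for u v
    proof -
      have "u \<rightarrow>\<^sup>*\<^bsub>C\<^esub> v" using conn that by (auto simp: strongly_connected_def)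
      then have "u \<rightarrow>\<^sup>* v" using ind by (auto intro: pre_digraph.reachable_mono)
      then have "(u, v) \<in> arcs_ends G" using adj that by blast
      then show ?thesis using that by (auto simp: arcs_ends_conv ends arcs)
    qed
    moreover have "u \<in> verts C \<and> v \<in> verts C \<and> u \<noteq> v" if "(u, v) \<in> arcs_ends C" for u v
      using that C.adj_in_verts C.adj_not_same by blast
    ultimately have "arcs_ends C = {(u, v). (u, v) \<in> verts C \<times> verts C \<and> u \<noteq> v}" by blast
    then show ?thesis using C.graph_axioms by (simp add: complete_digraph_def)
  qed
  then show "cluster_graph G" unfolding cluster_graph_def using graph_axioms by blast
qed

lemma (in graph) pair_graph_complement: "pair_graph (complement_graph G)"
proof -
  have "parcs (complement_graph G) \<subseteq> verts G \<times> verts G"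
    by (auto simp: complement_graph_def)
  then have "finite (parcs (complement_graph G))"
    by (rule finite_subset) simp
  then show ?thesis
    by unfold_locales (auto simp: complement_graph_def symmetric_def intro!: symI dest: graph_symmetric)
qed

text \<open>Non-adjacency and adjacency in the complement graph differ on the diagonal; agreement on
  distinct vertices suffices to exchange them.\<close>

lemma cluster_on_cong:
  assumes "\<And>x y. x \<in> S \<Longrightarrow> y \<in> S \<Longrightarrow> x \<noteq> y \<Longrightarrow> R x y = R' x y"
  shows "cluster_on R S = cluster_on R' S"
  using assms unfolding cluster_on_def by blast

lemma (in graph) co_cluster_graph_iff:
  "co_cluster_graph G \<longleftrightarrow> cluster_on (\<lambda>x y. (x, y) \<notin> arcs_ends G) (verts G)"
proof -
  interpret C: pair_graph "complement_graph G" by (rule pair_graph_complement)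
  have "co_cluster_graph G \<longleftrightarrow> cluster_graph (with_proj (complement_graph G))"
    by (simp add: co_cluster_graph_def graph_axioms)
  also have "\<dots> \<longleftrightarrow> cluster_on (\<lambda>x y. (x, y) \<in> parcs (complement_graph G)) (verts G)"
    using C.cluster_graph_iff by (simp add: complement_graph_def)
  also have "\<dots> \<longleftrightarrow> cluster_on (\<lambda>x y. (x, y) \<notin> arcs_ends G) (verts G)"
    by (rule cluster_on_cong) (auto simp: complement_graph_def)
  finally show ?thesis .
qed

lemma arcs_ends_induce:
  "arcs_ends (G \<restriction> S) = {(u, v) \<in> arcs_ends G. u \<in> S \<and> v \<in> S}"
  by (auto simp: arcs_ends_conv)

lemma (in graph) polar_graph_induce_iff:
  assumes S: "S \<subseteq> verts G"
  shows "polar_graph (G \<restriction> S) \<longleftrightarrow> (\<exists>S1 S2. S1 \<union> S2 = S \<and> S1 \<inter> S2 = {} \<and>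
    cluster_on (\<lambda>x y. (x, y) \<in> arcs_ends G) S1 \<and> cluster_on (\<lambda>x y. (x, y) \<notin> arcs_ends G) S2)"
proof -
  interpret GS: graph "G \<restriction> S" using S by (rule graph_induce)
  have "cluster_graph ((G \<restriction> S) \<restriction> S') \<longleftrightarrow> cluster_on (\<lambda>x y. (x, y) \<in> arcs_ends G) S'"
    "co_cluster_graph ((G \<restriction> S) \<restriction> S') \<longleftrightarrow> cluster_on (\<lambda>x y. (x, y) \<notin> arcs_ends G) S'"
    if "S' \<subseteq> S" for S'
  proof -
    interpret GS': graph "(G \<restriction> S) \<restriction> S'" using that by (intro GS.graph_induce) simp
    show "cluster_graph ((G \<restriction> S) \<restriction> S') \<longleftrightarrow> cluster_on (\<lambda>x y. (x, y) \<in> arcs_ends G) S'"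
      unfolding GS'.cluster_graph_iff unfolding induce_subgraph_verts
      by (rule cluster_on_cong) (use that in \<open>simp add: arcs_ends_induce subset_iff\<close>)
    show "co_cluster_graph ((G \<restriction> S) \<restriction> S') \<longleftrightarrow> cluster_on (\<lambda>x y. (x, y) \<notin> arcs_ends G) S'"
      unfolding GS'.co_cluster_graph_iff unfolding induce_subgraph_verts
      by (rule cluster_on_cong) (use that in \<open>simp add: arcs_ends_induce subset_iff\<close>)
  qed
  then show ?thesis
    unfolding polar_graph_def induce_subgraph_verts by (metis Un_upper1 Un_upper2)
qed

lemma chain_cut_of_mim:
  assumes G: "pair_graph G" and mim: "mim (with_proj G) A \<le> 1"
  shows "chain_cut (\<lambda>x y. (x, y) \<in> parcs G) (pverts G) A"
  unfolding chain_cut_def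
proof (intro ballI impI, rule ccontr)
  interpret pair_graph G by (rule G)
  fix a b c d
  assume *: "a \<in> A" "b \<in> A" "c \<in> pverts G - A" "d \<in> pverts G - A" "(a, c) \<in> parcs G"
    "(b, d) \<in> parcs G" "\<not> ((a, d) \<in> parcs G \<or> (b, c) \<in> parcs G)"
  let ?C = "with_proj (cut_graph (with_proj G) A)"
  have sym: "(v, u) \<in> parcs G" if "(u, v) \<in> parcs G" for u v
    using that graph_symmetric by auto
  have arcs: "arcs_ends ?C = {(u, v) \<in> parcs G. u \<in> A \<longleftrightarrow> v \<notin> A}"
    by (simp add: cut_graph_def)
  \<comment> \<open>The four ends are distinct: \<open>a = b\<close> or \<open>c = d\<close> would
    turn one of the two edges into the excluded pair \<open>(a, d)\<close>.\<close>
  have "induced_matching ?C {{a, c}, {b, d}}"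
    unfolding induced_matching_def arcs using * sym by (auto simp: image_iff)
  moreover have "card {{a, c}, {b, d}} = 2"
    using * by (auto simp: card_insert_if doubleton_eq_iff)
  ultimately have two: "2 \<in> card ` {M. induced_matching ?C M}" by force
  have "finite ((\<lambda>(u, v). {u, v}) ` arcs_ends ?C)"
    unfolding arcs by (intro finite_imageI finite_subset[OF _ pair_finite_arcs]) auto
  then have "finite {M. induced_matching ?C M}"
    by (rule finite_subset[OF _ finite_Pow_iff[THEN iffD2], rotated]) (auto simp: induced_matching_def)
  then have "2 \<le> mim (with_proj G) A"
    unfolding mim_def using two by (intro Max_ge) auto
  with mim show False by simp
qed

lemma finite_edge_cuts: "finite (edge_cuts T)"
  by (induction T) auto

lemma subtree_cuts_subset: "subtree_cuts T \<subseteq> insert (set (leaf_list T)) (edge_cuts T)"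
  by (induction T) auto

lemma chain_cut_subtree:
  assumes G: "pair_graph G" and T: "rooted_layout (with_proj G) T" "mim_width (with_proj G) T \<le> 1"
    and A: "A \<in> subtree_cuts T"
  shows "chain_cut (\<lambda>x y. (x, y) \<in> parcs G) (pverts G) A"
proof (cases "A \<in> edge_cuts T")
  case True
  then have "mim (with_proj G) A \<le> mim_width (with_proj G) T"
    unfolding mim_width_def by (intro Max_ge) (auto simp: finite_edge_cuts)
  with G T show ?thesis by (intro chain_cut_of_mim) auto
next
  case False
  \<comment> \<open>Only the root is left, and there the other side of the cut is empty.\<close>
  then have "A = pverts G"
    using A T(1) subtree_cuts_subset[of T] by (auto simp: rooted_layout_def)
  then show ?thesis by (simp add: chain_cut_def)
qed

section \<open>Encoded instances and the final assembly\<close>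

definition matrix :: "nat pair_pre_digraph \<Rightarrow> bool list list" where
  "matrix G = map (\<lambda>u. map (\<lambda>v. (u, v) \<in> parcs G) [0..<card (pverts G)]) [0..<card (pverts G)]"

lemma hd_or_drop: "hd_or d (drop i xs) = (if i < length xs then xs ! i else d)"
  by (auto simp: hd_or_def Cons_nth_drop_Suc[symmetric] split: list.split)

lemma adj_matrix:
  assumes "pair_graph G" "pverts G = {..<card (pverts G)}"
  shows "adj (matrix G) u v \<longleftrightarrow> (u, v) \<in> parcs G"
proof -
  interpret pair_graph G by fact
  have "u < card (pverts G) \<and> v < card (pverts G)" if "(u, v) \<in> parcs G"
    using in_arcsD1[OF that] in_arcsD2[OF that] assms(2) by blast
  then show ?thesis by (auto simp: adj_def hd_or_drop matrix_def)
qed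

lemma enc_list_map: "enc_list f (map g xs) = enc_list (\<lambda>x. f (g x)) xs"
  by (induction xs) auto

lemma enc_nat_layout: "enc T = Defs.enc_layout T"
  by (induction T) (simp_all add: enc_nat_inst)

lemma enc_instance_eq: "enc_instance (G, T) = enc (matrix G, T)"
  by (simp add: enc_instance_def enc_graph_def matrix_def Let_def enc_nat_layout enc_list_inst
      enc_list_map enc_bool_inst)

text \<open>The main function has index 0, so the expression is put in front of its program and all
  calls move by one.\<close>

lemma poly_time_run:
  assumes "poly_time f"
  obtains P p where "\<And>x. \<exists>t \<le> poly p (size (enc x)). run P (enc x) (enc (f x)) t"
proof -
  from assms obtain P e T where f: "computes P e f T" and T: "poly_bounded T"
    unfolding poly_time_def by blast
  let ?P = "shift 1 e # map (shift 1) P"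
  have "\<exists>t \<le> 2 + size (enc x) + T x. run ?P (enc x) (enc (f x)) t" for x
  proof -
    from computesE[OF f] obtain t where t: "t \<le> T x" "eval P [enc x] e (enc (f x)) t" .
    have "eval ?P [enc x] (?P ! 0) (enc (f x)) t"
      using eval_link(1)[OF t(2), of "[shift 1 e]" "[]"] by simp
    moreover have "evals ?P [enc x] [EVar 0] [enc x] (1 + size (enc x) + 0)"
      by (intro eval_evals.evals_Cons eval_evals.evals_Nil eval_EVar) simp_all
    ultimately have "run ?P (enc x) (enc (f x)) (1 + size (enc x) + 0 + t + 1)"
      unfolding run_def by (intro eval_evals.ECall) simp_all
    with t(1) show ?thesis by (intro exI[of _ "1 + size (enc x) + 0 + t + 1"]) simp
  qed
  moreover have "poly_bounded (\<lambda>x. 2 + size (enc x) + T x)"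
    by (intro poly_bounded_intros T)
  then obtain p where "\<And>x. 2 + size (enc x) + T x \<le> poly p (size (enc x))"
    by (rule poly_boundedE) blast
  ultimately show thesis using that by (meson le_trans)
qed

lemma polar_subset_correct:
  assumes "(G, T) \<in> layout_instances 1"
  shows "max_induced_polar (G, T) (polar_subset (matrix G, T))"
proof -
  have G: "pair_graph G" and V: "pverts G = {..<card (pverts G)}"
    and T: "rooted_layout (with_proj G) T" "mim_width (with_proj G) T \<le> 1"
    using assms by (auto simp: layout_instances_def)
  interpret pair_graph G by (rule G)
  let ?M = "matrix G" and ?V = "leaf_list T"
  have leaves: "distinct ?V" "set ?V = pverts G" using T(1) by (auto simp: rooted_layout_def)
  have M: "adj ?M = (\<lambda>u v. (u, v) \<in> parcs G)" using adj_matrix[OF G V] by blast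
  have sym: "symp (adj ?M)" unfolding M using graph_symmetric by (auto intro: sympI)
  have polar: "polar_graph (with_proj G \<restriction> S) \<longleftrightarrow> (\<exists>S1 S2. S1 \<union> S2 = S \<and> S1 \<inter> S2 = {} \<and>
      cluster_on (adj_is ?M True) S1 \<and> cluster_on (adj_is ?M False) S2)" if "S \<subseteq> pverts G" for S
    using polar_graph_induce_iff[of S] that unfolding M by simp
  have cuts: "\<forall>A \<in> subtree_cuts T. chain_cut (adj ?M) (set ?V) A"
    unfolding M leaves(2) using chain_cut_subtree[OF G T] by blast
  let ?C = "candidates (?M, ?V) T"
  have complete: "\<exists>p \<in> set ?C. card S \<le> length (covered p)"
    if S: "S \<subseteq> pverts G" "polar_graph (with_proj G \<restriction> S)" for S
  proof -
    from S(2)[unfolded polar[OF S(1)]] obtain S1 S2 where S12: "S1 \<union> S2 = S" "S1 \<inter> S2 = {}"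
      "cluster_on (adj_is ?M True) S1" "cluster_on (adj_is ?M False) S2" by blast
    moreover from this S have "S1 \<subseteq> set ?V" "S2 \<subseteq> set ?V" using leaves by blast+
    ultimately have "\<exists>p \<in> set ?C. card ((S1 \<union> S2) \<inter> set ?V) \<le> length (covered p)"
      using candidates_complete[OF sym, of S1 ?V S2 T] leaves(1) cuts by blast
    moreover have "(S1 \<union> S2) \<inter> set ?V = S" using S12(1) S(1) leaves(2) by blast
    ultimately show ?thesis by simp
  qed
  have sound: "distinct (covered p)" "set (covered p) \<subseteq> pverts G"
    "polar_graph (with_proj G \<restriction> set (covered p))" if "p \<in> set ?C" for p
  proof -
    have p: "partial_solution ?M (pverts G) p"
      using partial_solution_candidates[OF sym leaves(1) that] leaves(2) by simp
    show "distinct (covered p)" and sub: "set (covered p) \<subseteq> pverts G"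
      using p by (simp_all add: partial_solution_def)
    let ?S1 = "set (fst (fst p)) \<union> set (snd (fst p))" and ?S2 = "set (fst (snd p)) \<union> set (snd (snd p))"
    have "cluster_on (adj_is ?M True) ?S1" "cluster_on (adj_is ?M False) ?S2"
      using half_ok_cluster[OF _ sym] p unfolding partial_solution_def by blast+
    moreover have "?S1 \<union> ?S2 = set (covered p)" "?S1 \<inter> ?S2 = {}"
      using p by (auto simp: covered_def partial_solution_def)
    ultimately show "polar_graph (with_proj G \<restriction> set (covered p))"
      unfolding polar[OF sub] by blast
  qed
  \<comment> \<open>The empty set is polar, so there is at least one candidate and
    \<open>largest\<close> returns exactly one.\<close>
  have "polar_graph (with_proj G \<restriction> {})" by (subst polar) (auto simp: cluster_on_def)
  from complete[OF _ this] obtain p0 where "p0 \<in> set ?C" by auto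
  from largest_member[OF this] obtain p where "p \<in> set (largest ?C)" by blast
  with length_largest_le[of ?C] have largest: "largest ?C = [p]"
    by (cases "largest ?C") (auto simp: le_Suc_eq)
  then have result: "polar_subset (?M, T) = covered p" by (simp add: polar_subset_def)
  have p: "p \<in> set ?C" using largest set_largest_subset[of ?C] by simp
  have "card S \<le> card (set (covered p))"
    if S: "S \<subseteq> pverts G" "polar_graph (with_proj G \<restriction> S)" for S
  proof -
    from complete[OF S] obtain q where q: "q \<in> set ?C" "card S \<le> length (covered q)" by blast
    from largest_member[OF q(1)] largest have "length (covered q) \<le> length (covered p)" by simp
    with q(2) sound(1)[OF p] show ?thesis by (simp add: distinct_card)
  qed
  then show ?thesis
    unfolding max_induced_polar_def result using sound[OF p]
    by (auto simp: is_arg_max_linorder)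
qed

theorem theorem8:
  shows "poly_time_search enc_instance (enc_list enc_nat) (layout_instances 1) max_induced_polar"
proof -
  obtain P p where
    P: "\<And>x. \<exists>t \<le> poly p (size (enc x)). run P (enc x) (enc (polar_subset x)) t"
    by (rule poly_time_run[OF poly_time_polar_subset]) blast
  have "enc xs = enc_list enc_nat xs" for xs :: "nat list"
    by (simp add: enc_list_inst enc_nat_inst)
  with P polar_subset_correct show ?thesis
    unfolding poly_time_search_def
    by (intro exI[of _ P] exI[of _ p]) (metis enc_instance_eq surj_pair)
qed

end
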